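(* The quantified constraint satisfaction problem (QCSP) is fixed-parameter tractable when parameterized by the number of existentially quantified variables plus the domain size plus the maximum arity of any relation.
   Context: A CSP instance is $(X,D,C)$ with variables $X=\{x_1,\dots,x_n\}$, finite domains $D=\{D_1,\dots,D_n\}$ (one per variable) and constraints $C_j=R_j(x_{j_1},\dots,x_{j_{\mathrm{ar}(R_j)}})$ where $R_j\subseteq D_{j_1}\times\dots\times D_{j_{\mathrm{ar}(R_j)}}$; an assignment $\alpha$ with $\alpha(x_i)\in D_i$ satisfies it if every constraint tuple lies in its relation. A QCSP instance is $\mathcal{Q}.\phi$ where $\mathcal{Q}=Q_1x_1\dots Q_nx_n$, $Q_i\in\{\forall,\exists\}$, and $\phi$ is a CSP instance on these variables; it is true if recursively: for $Q_1=\exists$, the rest is true for at least one value of $x_1$ in $D_1$; for $Q_1=\forall$, the rest is true for all values of $x_1$ in $D_1$; with no quantifiers left, all constraints are satisfied. QCSP is the problem of deciding whether such an instance is true. The domain size parameter is $\max_i|D_i|$ and the arity parameter is $\max_j \mathrm{ar}(R_j)$. *)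

theory Defs
  imports Complex_Main "HOL-Library.Log_Nat"
begin

section \<open>Random access machines\<close>

text \<open>
  The machine model is the random access machine with unit-cost instructions, in the style of
  Papadimitriou (Computational Complexity, Section 2.6): a fixed program, registers indexed by the
  natural numbers and initially zero, and a separate read-only array holding the input numbers.
  Registers hold natural numbers, and the only arithmetic is addition and truncated
  subtraction, so that after \<open>t\<close> steps every register has at most \<open>t\<close> more bits than the largest
  number in the program or the input. Hence unit-cost time is polynomially related to Turing machine time.
\<close>

datatype instr =
    SetConst nat nat   \<comment> \<open>\<open>r := c\<close>\<close>
  | Add nat nat nat    \<comment> \<open>\<open>r := a + b\<close>\<close>
  | Sub nat nat nat    \<comment> \<open>\<open>r := a - b\<close>, truncated at zero\<close>
  | Load nat nat       \<comment> \<open>\<open>r := M[a]\<close>\<close>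
  | Store nat nat      \<comment> \<open>\<open>M[a] := r\<close>\<close>
  | Read nat nat       \<comment> \<open>\<open>r := input[a]\<close>, and 0 beyond the end of the input\<close>
  | Jump nat
  | JumpZero nat nat   \<comment> \<open>jump to \<open>l\<close> if \<open>r = 0\<close>\<close>

text \<open>A configuration consists of the program counter and the contents of the registers.\<close>

type_synonym config = "nat \<times> (nat \<Rightarrow> nat)"

fun exec_instr :: "nat list \<Rightarrow> instr \<Rightarrow> config \<Rightarrow> config" where
  "exec_instr inp (SetConst r c) (pc, M) = (Suc pc, M(r := c))"
| "exec_instr inp (Add r a b) (pc, M) = (Suc pc, M(r := M a + M b))"
| "exec_instr inp (Sub r a b) (pc, M) = (Suc pc, M(r := M a - M b))"
| "exec_instr inp (Load r a) (pc, M) = (Suc pc, M(r := M (M a)))"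
| "exec_instr inp (Store a r) (pc, M) = (Suc pc, M(M a := M r))"
| "exec_instr inp (Read r a) (pc, M) =
    (Suc pc, M(r := (if M a < length inp then inp ! M a else 0)))"
| "exec_instr inp (Jump l) (pc, M) = (l, M)"
| "exec_instr inp (JumpZero r l) (pc, M) = ((if M r = 0 then l else Suc pc), M)"

text \<open>
  The machine halts when the program counter leaves the program; a halted configuration
  is a fixed point of the step function.
\<close>

definition ram_step :: "instr list \<Rightarrow> nat list \<Rightarrow> config \<Rightarrow> config" where
  "ram_step P inp cf = (if fst cf < length P then exec_instr inp (P ! fst cf) cf else cf)"

text \<open>On input \<open>inp\<close>, program \<open>P\<close> halts after at most \<open>t\<close> steps with \<open>y\<close> in register 0.\<close>

definition ram_outputs_within :: "instr list \<Rightarrow> nat list \<Rightarrow> nat \<Rightarrow> nat \<Rightarrow> bool" where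
  "ram_outputs_within P inp t y \<longleftrightarrow>
    (let (pc, M) = (ram_step P inp ^^ t) (0, \<lambda>_. 0) in length P \<le> pc \<and> M 0 = y)"

definition ram_computable :: "(nat \<Rightarrow> nat) \<Rightarrow> bool" where
  "ram_computable f \<longleftrightarrow> (\<exists>P. \<forall>k. \<exists>t. ram_outputs_within P [k] t (f k))"

text \<open>The total length of the binary representations of the input numbers, where 0 has length 1.\<close>

definition input_size :: "nat list \<Rightarrow> nat" where
  "input_size w = (\<Sum>a\<leftarrow>w. max 1 (floorlog 2 a))"


section \<open>Fixed-parameter tractability\<close>

text \<open>
  A parameterized decision problem is given by its set of instances, the set of
  yes-instances, and the parameter of each instance; \<open>enc\<close> presents instances to the machine.
  A single program decides all instances in time \<open>f(k) * n^c\<close>, with \<open>f\<close> computable and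
  \<open>c\<close> constant. The machine is not given the parameter.
\<close>

definition fixed_parameter_tractable ::
    "('a \<Rightarrow> nat list) \<Rightarrow> 'a set \<Rightarrow> 'a set \<Rightarrow> ('a \<Rightarrow> nat) \<Rightarrow> bool" where
  "fixed_parameter_tractable enc Inst Yes \<kappa> \<longleftrightarrow>
    (\<exists>P f c. ram_computable f \<and>
      (\<forall>x\<in>Inst. ram_outputs_within P (enc x) (f (\<kappa> x) * input_size (enc x) ^ c)
                  (if x \<in> Yes then 1 else 0)))"


section \<open>Quantified constraint satisfaction\<close>

datatype quantifier = Forall | Exists

text \<open>
  The variables are named by their positions \<open>0, ..., n - 1\<close> in the prefix, and domain values by
  natural numbers. The \<open>i\<close>-th prefix entry is the quantifier of variable \<open>i\<close> together with its
  domain. A constraint is a scope (a list of variables, possibly with repetitions)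
  together with a relation. Domains and relations are finite sets, listed without repetition.
\<close>

type_synonym qconstraint = "nat list \<times> nat list list"

record qcsp =
  qprefix :: "(quantifier \<times> nat list) list"
  constraints :: "qconstraint list"

definition qdomain :: "qcsp \<Rightarrow> nat \<Rightarrow> nat set" where
  "qdomain I i = set (snd (qprefix I ! i))"

definition wf_qcsp :: "qcsp \<Rightarrow> bool" where
  "wf_qcsp I \<longleftrightarrow>
    (\<forall>(q, D)\<in>set (qprefix I). distinct D) \<and>
    (\<forall>(s, R)\<in>set (constraints I).
       (\<forall>i\<in>set s. i < length (qprefix I)) \<and>
       distinct R \<and>
       (\<forall>t\<in>set R. list_all2 (\<lambda>i v. v \<in> qdomain I i) s t))"

text \<open>\<open>\<alpha> ! i\<close> is the value of variable \<open>i\<close>.\<close>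

definition satisfies :: "nat list \<Rightarrow> qconstraint \<Rightarrow> bool" where
  "satisfies \<alpha> C \<longleftrightarrow> map (\<lambda>i. \<alpha> ! i) (fst C) \<in> set (snd C)"

text \<open>
  The second argument is the assignment to the variables whose quantifiers have already been
  removed from the prefix.
\<close>

fun qtrue :: "(quantifier \<times> nat list) list \<Rightarrow> nat list \<Rightarrow> qconstraint list \<Rightarrow> bool" where
  "qtrue [] \<alpha> Cs \<longleftrightarrow> (\<forall>C\<in>set Cs. satisfies \<alpha> C)"
| "qtrue ((Exists, D) # Q) \<alpha> Cs \<longleftrightarrow> (\<exists>v\<in>set D. qtrue Q (\<alpha> @ [v]) Cs)"
| "qtrue ((Forall, D) # Q) \<alpha> Cs \<longleftrightarrow> (\<forall>v\<in>set D. qtrue Q (\<alpha> @ [v]) Cs)"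

definition qcsp_true :: "qcsp \<Rightarrow> bool" where
  "qcsp_true I \<longleftrightarrow> qtrue (qprefix I) [] (constraints I)"

definition num_existential :: "qcsp \<Rightarrow> nat" where
  "num_existential I = card {i. i < length (qprefix I) \<and> fst (qprefix I ! i) = Exists}"

text \<open>The inserted 0 is the value for instances without variables, respectively constraints.\<close>

definition domain_size :: "qcsp \<Rightarrow> nat" where
  "domain_size I = Max (insert 0 ((\<lambda>i. card (qdomain I i)) ` {..<length (qprefix I)}))"

definition max_arity :: "qcsp \<Rightarrow> nat" where
  "max_arity I = Max (insert 0 ((\<lambda>C. length (fst C)) ` set (constraints I)))"


subsection \<open>Encoding of instances\<close>

text \<open>Lists are preceded by their length, which makes the encoding uniquely decodable.\<close>

definition enc_list :: "('a \<Rightarrow> nat list) \<Rightarrow> 'a list \<Rightarrow> nat list" where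
  "enc_list e xs = length xs # concat (map e xs)"

definition enc_nats :: "nat list \<Rightarrow> nat list" where
  "enc_nats = enc_list (\<lambda>v. [v])"

fun enc_quantified :: "quantifier \<times> nat list \<Rightarrow> nat list" where
  "enc_quantified (q, D) = (case q of Forall \<Rightarrow> 0 | Exists \<Rightarrow> 1) # enc_nats D"

fun enc_constraint :: "qconstraint \<Rightarrow> nat list" where
  "enc_constraint (s, R) = enc_nats s @ enc_list enc_nats R"

definition enc_qcsp :: "qcsp \<Rightarrow> nat list" where
  "enc_qcsp I = enc_list enc_quantified (qprefix I) @ enc_list enc_constraint (constraints I)"

definition prefix_free :: "('a \<Rightarrow> nat list) \<Rightarrow> bool" where
  "prefix_free e \<longleftrightarrow> (\<forall>x y u v. e x @ u = e y @ v \<longrightarrow> x = y \<and> u = v)"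

lemma prefix_freeI:
  "(\<And>x y u v. e x @ u = e y @ v \<Longrightarrow> x = y \<and> u = v) \<Longrightarrow> prefix_free e"
  unfolding prefix_free_def by blast

lemma prefix_freeD:
  "prefix_free e \<Longrightarrow> e x @ u = e y @ v \<Longrightarrow> x = y \<and> u = v"
  unfolding prefix_free_def by blast

lemma prefix_free_enc_list:
  assumes "prefix_free e"
  shows "prefix_free (enc_list e)"
proof -
  have *: "xs = ys \<and> u = v"
    if "length xs = length ys" "concat (map e xs) @ u = concat (map e ys) @ v" for xs ys u v
    using that
  proof (induction xs ys rule: list_induct2)
    case Nil
    then show ?case by simp
  next
    case (Cons x xs y ys)
    from Cons.prems have "e x @ (concat (map e xs) @ u) = e y @ (concat (map e ys) @ v)"
      by simp
    from prefix_freeD[OF assms this] Cons.IH show ?case by simp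
  qed
  show ?thesis
  proof (rule prefix_freeI)
    fix xs ys u v
    assume "enc_list e xs @ u = enc_list e ys @ v"
    then have "length xs = length ys" "concat (map e xs) @ u = concat (map e ys) @ v"
      by (simp_all add: enc_list_def)
    then show "xs = ys \<and> u = v" by (rule *)
  qed
qed

lemma prefix_free_enc_nats: "prefix_free enc_nats"
  unfolding enc_nats_def by (rule prefix_free_enc_list) (simp add: prefix_free_def)

lemma prefix_free_enc_quantified: "prefix_free enc_quantified"
proof (rule prefix_freeI)
  fix x y :: "quantifier \<times> nat list" and u v
  assume eq: "enc_quantified x @ u = enc_quantified y @ v"
  obtain p D q E where xy: "x = (p, D)" "y = (q, E)" by (metis surj_pair)
  from eq have "enc_nats D @ u = enc_nats E @ v" "p = q"
    by (simp_all add: xy split: quantifier.splits)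
  with prefix_freeD[OF prefix_free_enc_nats this(1)] show "x = y \<and> u = v" by (simp add: xy)
qed

lemma prefix_free_enc_constraint: "prefix_free enc_constraint"
proof (rule prefix_freeI)
  fix x y :: qconstraint and u v
  assume eq: "enc_constraint x @ u = enc_constraint y @ v"
  obtain s R s' R' where xy: "x = (s, R)" "y = (s', R')" by (metis surj_pair)
  from eq have "enc_nats s @ (enc_list enc_nats R @ u) = enc_nats s' @ (enc_list enc_nats R' @ v)"
    by (simp add: xy)
  from prefix_freeD[OF prefix_free_enc_nats this]
  have 1: "s = s'" and 2: "enc_list enc_nats R @ u = enc_list enc_nats R' @ v" by simp_all
  from prefix_freeD[OF prefix_free_enc_list[OF prefix_free_enc_nats] 2] 1
  show "x = y \<and> u = v" by (simp add: xy)
qed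

lemma inj_enc_qcsp: "inj enc_qcsp"
proof (rule injI)
  fix I J :: qcsp
  assume "enc_qcsp I = enc_qcsp J"
  from prefix_freeD[OF prefix_free_enc_list[OF prefix_free_enc_quantified] this[unfolded enc_qcsp_def]]
  have 1: "qprefix I = qprefix J"
    and 2: "enc_list enc_constraint (constraints I) @ [] = enc_list enc_constraint (constraints J) @ []"
    by simp_all
  from prefix_freeD[OF prefix_free_enc_list[OF prefix_free_enc_constraint] 2] 1
  show "I = J" by simp
qed

end

theory Submission
  imports Defs
begin

text \<open>
  If all domains are nonempty, the instance is false iff the universal player has a strategy that
  violates a constraint in every play. With \<open>K\<close> the parameter, there are at most \<open>2 ^ (K * K)\<close> plays
  against a fixed strategy, one for each choice of the existential values, and in each of them the
  strategy needs only one violated constraint, that is, at most \<open>K\<close> variables. So the moves of the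
  strategy matter for at most \<open>K * 2 ^ (K * K)\<close> variables. These are kept apart by selecting a suitable set
  of bits of their indices; such a set is a mask \<open>w\<close>, of which there are only linearly many, while the
  number of hash values is bounded in terms of \<open>K\<close>. A table that maps a hash value and the preceding
  existential moves to a value is coded as a number \<open>G\<close>, bounded in terms of \<open>K\<close>. It suffices to try
  all pairs \<open>(w, G)\<close> against all existential choices. Trying a pair is sound for every mask, whether or not it
  separates the relevant variables, because every pair defines a strategy.

  No data structure is kept: each intermediate quantity is recomputed from the input whenever it is
  needed, so that the whole algorithm is an expression in a language with bounded iteration.
  Its running time is polynomial in the largest iteration count.
\<close>

section \<open>A language of bounded iteration and its compilation\<close>

datatype exp =
    Var nat
  | Const nat
  | Plus exp exp
  | Minus exp exp
  | Inp exp
  | IfZero exp exp exp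
  | Iter exp exp exp
  | App exp "exp list"

definition rd :: "nat list \<Rightarrow> nat \<Rightarrow> nat" where
  "rd inp a = (if a < length inp then inp ! a else 0)"

text \<open>
  Variables are de Bruijn levels: \<open>Iter n i s\<close> iterates \<open>s\<close>, which sees the counter and the
  accumulator as the last two entries of its environment, and \<open>App f es\<close> evaluates \<open>f\<close> in an
  environment that consists of the values of \<open>es\<close> only.
\<close>

fun eval :: "nat list \<Rightarrow> nat list \<Rightarrow> exp \<Rightarrow> nat" where
  "eval inp env (Var i) = (if i < length env then env ! i else 0)"
| "eval inp env (Const c) = c"
| "eval inp env (Plus a b) = eval inp env a + eval inp env b"
| "eval inp env (Minus a b) = eval inp env a - eval inp env b"
| "eval inp env (Inp a) = rd inp (eval inp env a)"
| "eval inp env (IfZero c a b) = (if eval inp env c = 0 then eval inp env a else eval inp env b)"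
| "eval inp env (Iter n i s) =
    rec_nat (eval inp env i) (\<lambda>j a. eval inp (env @ [j, a]) s) (eval inp env n)"
| "eval inp env (App f es) = eval inp (map (eval inp env) es) f"

text \<open>All iteration counts met during evaluation are at most \<open>N\<close>. Only the branch
  taken by \<open>IfZero\<close> is constrained, and a loop body only at the accumulators actually
  reached; other values may be large, as arithmetic has unit cost.\<close>

fun bnd :: "nat list \<Rightarrow> nat \<Rightarrow> nat list \<Rightarrow> exp \<Rightarrow> bool" where
  "bnd inp N env (Var i) = True"
| "bnd inp N env (Const c) = True"
| "bnd inp N env (Plus a b) = (bnd inp N env a \<and> bnd inp N env b)"
| "bnd inp N env (Minus a b) = (bnd inp N env a \<and> bnd inp N env b)"
| "bnd inp N env (Inp a) = bnd inp N env a"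
| "bnd inp N env (IfZero c a b) =
    (bnd inp N env c \<and> (if eval inp env c = 0 then bnd inp N env a else bnd inp N env b))"
| "bnd inp N env (Iter n i s) =
    (bnd inp N env n \<and> bnd inp N env i \<and> eval inp env n \<le> N \<and>
     (\<forall>j<eval inp env n.
        bnd inp N (env @ [j, rec_nat (eval inp env i) (\<lambda>j a. eval inp (env @ [j, a]) s) j]) s))"
| "bnd inp N env (App f es) =
    ((\<forall>e\<in>set es. bnd inp N env e) \<and> bnd inp N (map (eval inp env) es) f)"

lemma bnd_mono: "bnd inp N env e \<Longrightarrow> N \<le> N' \<Longrightarrow> bnd inp N' env e"
proof (induction e arbitrary: env)
  case (Iter n i s)
  then show ?case by (auto intro: order_trans)
next
  case (App f es)
  then show ?case by auto
qed (auto split: if_splits)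

lemma ex_common_bound:
  fixes Q :: "nat \<Rightarrow> 'a \<Rightarrow> bool"
  assumes "finite S" "\<forall>x\<in>S. \<exists>N. Q N x" "\<And>N N' x. Q N x \<Longrightarrow> N \<le> N' \<Longrightarrow> Q N' x"
  shows "\<exists>N. \<forall>x\<in>S. Q N x"
proof -
  from assms(2) obtain g where g: "\<forall>x\<in>S. Q (g x) x" by metis
  have "\<forall>x\<in>S. Q (sum g S) x"
    using g assms(1) by (auto intro: assms(3) member_le_sum)
  then show ?thesis by blast
qed

text \<open>Each count is fixed before its loop starts, so evaluation always ends. This alone makes
  every expression RAM computable, as is needed for the time function of the parameter.\<close>

lemma ex_bnd: "\<exists>N. bnd inp N env e"
proof (induction e arbitrary: env)
  case (Plus a b)
  obtain N1 N2 where "bnd inp N1 env a" "bnd inp N2 env b" using Plus by metis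
  then have "bnd inp (N1 + N2) env (Plus a b)" by (auto intro: bnd_mono)
  then show ?case by blast
next
  case (Minus a b)
  obtain N1 N2 where "bnd inp N1 env a" "bnd inp N2 env b" using Minus by metis
  then have "bnd inp (N1 + N2) env (Minus a b)" by (auto intro: bnd_mono)
  then show ?case by blast
next
  case (IfZero c a b)
  obtain N1 N2 N3 where "bnd inp N1 env c" "bnd inp N2 env a" "bnd inp N3 env b"
    using IfZero by metis
  then have "bnd inp (N1 + N2 + N3) env (IfZero c a b)" by (auto intro: bnd_mono)
  then show ?case by blast
next
  case (Iter n i s)
  let ?n = "eval inp env n"
  let ?e = "\<lambda>j. env @ [j, rec_nat (eval inp env i) (\<lambda>j a. eval inp (env @ [j, a]) s) j]"
  obtain N1 N2 where N12: "bnd inp N1 env n" "bnd inp N2 env i" using Iter by metis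
  have "\<exists>N. \<forall>j\<in>{..<?n}. bnd inp N (?e j) s"
    by (rule ex_common_bound) (use Iter in \<open>auto intro: bnd_mono\<close>)
  then obtain N3 where N3: "\<forall>j\<in>{..<?n}. bnd inp N3 (?e j) s" by blast
  have "bnd inp (N1 + N2 + N3 + ?n) env (Iter n i s)"
    using N12 N3 by (auto intro: bnd_mono)
  then show ?case by blast
next
  case (App f es)
  have "\<exists>N. \<forall>e\<in>set es. bnd inp N env e"
    by (rule ex_common_bound) (use App in \<open>auto intro: bnd_mono\<close>)
  then obtain N1 where N1: "\<forall>e\<in>set es. bnd inp N1 env e" by blast
  obtain N2 where N2: "bnd inp N2 (map (eval inp env) es) f" using App by metis
  have "bnd inp (N1 + N2) env (App f es)" using N1 N2 by (auto intro: bnd_mono)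
  then show ?case by blast
qed auto

text \<open>
  \<open>code p rs d e\<close> is placed at address \<open>p\<close>, finds variable \<open>i\<close> in register \<open>rs ! i\<close>, leaves the
  value of \<open>e\<close> in register \<open>d\<close> and preserves the registers below \<open>d\<close>.
\<close>

fun code :: "nat \<Rightarrow> nat list \<Rightarrow> nat \<Rightarrow> exp \<Rightarrow> instr list"
  and codes :: "nat \<Rightarrow> nat list \<Rightarrow> nat \<Rightarrow> exp list \<Rightarrow> instr list" where
  "code p rs d (Var i) =
    (if i < length rs then [SetConst d 0, Add d d (rs ! i)] else [SetConst d 0])"
| "code p rs d (Const c) = [SetConst d c]"
| "code p rs d (Plus a b) =
    (let c1 = code p rs d a; c2 = code (p + length c1) rs (Suc d) b
     in c1 @ c2 @ [Add d d (Suc d)])"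
| "code p rs d (Minus a b) =
    (let c1 = code p rs d a; c2 = code (p + length c1) rs (Suc d) b
     in c1 @ c2 @ [Sub d d (Suc d)])"
| "code p rs d (Inp a) = code p rs d a @ [Read d d]"
| "code p rs d (IfZero c a b) =
    (let c1 = code p rs d c;
         c2 = code (Suc (p + length c1)) rs d b;
         l = Suc (Suc (p + length c1 + length c2));
         c3 = code l rs d a
     in c1 @ JumpZero d l # c2 @ Jump (l + length c3) # c3)"
| "code p rs d (Iter n i s) =
    (let c1 = code p rs d i;
         c2 = code (p + length c1) rs (Suc d) n;
         l = Suc (p + length c1 + length c2);
         c3 = code (Suc l) (rs @ [d + 2, d]) (d + 3) s
     in c1 @ c2 @ [SetConst (d + 2) 0, JumpZero (Suc d) (l + length c3 + 7)] @ c3 @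
        [SetConst d 0, Add d d (d + 3), SetConst (d + 3) 1, Add (d + 2) (d + 2) (d + 3),
         Sub (Suc d) (Suc d) (d + 3), Jump l])"
| "code p rs d (App f es) =
    (let c1 = codes p rs (Suc d) es;
         d' = Suc d + length es;
         c2 = code (p + length c1) [Suc d..<d'] d' f
     in c1 @ c2 @ [SetConst d 0, Add d d d'])"
| "codes p rs d [] = []"
| "codes p rs d (e # es) =
    (let c1 = code p rs d e in c1 @ codes (p + length c1) rs (Suc d) es)"

text \<open>A round of a loop costs its body and seven steps: the test and the six instructions
  behind the body. The two further steps reset the counter and leave the loop. Both branches of
  \<open>IfZero\<close> are charged, so the bound depends on \<open>N\<close> and the expression
  only.\<close>

fun time_bound :: "nat \<Rightarrow> exp \<Rightarrow> nat" where
  "time_bound N (Var i) = 2"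
| "time_bound N (Const c) = 1"
| "time_bound N (Plus a b) = time_bound N a + time_bound N b + 1"
| "time_bound N (Minus a b) = time_bound N a + time_bound N b + 1"
| "time_bound N (Inp a) = time_bound N a + 1"
| "time_bound N (IfZero c a b) = time_bound N c + time_bound N a + time_bound N b + 2"
| "time_bound N (Iter n i s) = time_bound N i + time_bound N n + 2 + N * (time_bound N s + 7)"
| "time_bound N (App f es) = (\<Sum>e\<leftarrow>es. time_bound N e) + time_bound N f + 2"

lemma polynomial_sum_list:
  assumes "\<And>e. e \<in> set es \<Longrightarrow> \<exists>c k. \<forall>N\<ge>1. g N e \<le> c * N ^ k"
  shows "\<exists>c k. \<forall>N\<ge>1. (\<Sum>e\<leftarrow>es. g N e) \<le> (c::nat) * (N::nat) ^ k"
  using assms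
proof (induction es)
  case Nil
  then show ?case by auto
next
  case (Cons e es)
  obtain c k where 1: "\<forall>N\<ge>1. (\<Sum>e\<leftarrow>es. g N e) \<le> c * N ^ k"
    using Cons by (metis list.set_intros(2))
  obtain c' k' where 2: "\<forall>N\<ge>1. g N e \<le> c' * N ^ k'" using Cons.prems by force
  have "g N e + (\<Sum>e\<leftarrow>es. g N e) \<le> (c' + c) * N ^ (k' + k)" if "N \<ge> 1" for N
  proof -
    have "N ^ k' \<le> N ^ (k' + k)" "N ^ k \<le> N ^ (k' + k)"
      using that by (auto intro!: power_increasing)
    then have "c' * N ^ k' + c * N ^ k \<le> (c' + c) * N ^ (k' + k)"
      by (simp add: add_mono add_mult_distrib)
    with 1 2 that show ?thesis by (meson add_mono order_trans)
  qed
  then show ?case by (metis list.simps(9) sum_list.Cons)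
qed

text \<open>The expression is fixed, so its nested loops contribute a bounded number of factors
  \<open>N\<close>. The exponent found here becomes the constant exponent of the running
  time.\<close>

lemma time_bound_polynomial: "\<exists>c k. \<forall>N\<ge>1. time_bound N e \<le> c * N ^ k"
proof -
  have add: "\<exists>c k. \<forall>N\<ge>1. g N + h N \<le> (c::nat) * (N::nat) ^ k"
    if "\<exists>c k. \<forall>N\<ge>1. g N \<le> c * N ^ k" "\<exists>c k. \<forall>N\<ge>1. h N \<le> c * N ^ k" for g h
  proof -
    have "\<exists>c k. \<forall>N\<ge>1. (if b then g N else h N) \<le> (c::nat) * N ^ k" for b
      using that by (cases b) simp_all
    from polynomial_sum_list[of "[True, False]" "\<lambda>N b. if b then g N else h N", OF this]
    show ?thesis by simp
  qed
  have const: "\<exists>c k. \<forall>N\<ge>1. m \<le> (c::nat) * (N::nat) ^ k" for m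
    by (rule exI[of _ m], rule exI[of _ 0]) simp
  have mult: "\<exists>c k. \<forall>N\<ge>1. N * g N \<le> (c::nat) * (N::nat) ^ k"
    if "\<exists>c k. \<forall>N\<ge>1. g N \<le> c * N ^ k" for g
  proof -
    from that obtain c k where "\<forall>N\<ge>1. g N \<le> c * N ^ k" by blast
    then have "\<forall>N\<ge>1. N * g N \<le> c * N ^ Suc k" by simp
    then show ?thesis by blast
  qed
  show ?thesis
  proof (induction e)
    case (App f es)
    show ?case unfolding time_bound.simps
      by (intro add const App polynomial_sum_list)
  qed (unfold time_bound.simps, (intro add const mult; assumption)+)
qed

section \<open>Correctness of the compiler\<close>

definition code_at :: "instr list \<Rightarrow> nat \<Rightarrow> instr list \<Rightarrow> bool" where
  "code_at P p c \<longleftrightarrow> (\<forall>i<length c. p + i < length P \<and> P ! (p + i) = c ! i)"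

lemma code_at_Nil [simp]: "code_at P p []"
  by (simp add: code_at_def)

lemma code_at_Cons [simp]:
  "code_at P p (i # c) \<longleftrightarrow> p < length P \<and> P ! p = i \<and> code_at P (Suc p) c"
  by (fastforce simp: code_at_def nth_Cons less_Suc_eq_0_disj split: nat.splits)

lemma code_at_append [simp]:
  "code_at P p (c @ c') \<longleftrightarrow> code_at P p c \<and> code_at P (p + length c) c'"
  by (induction c arbitrary: p) auto

definition reaches :: "instr list \<Rightarrow> nat list \<Rightarrow> nat \<Rightarrow> config \<Rightarrow> config \<Rightarrow> bool" where
  "reaches P inp T cf cf' \<longleftrightarrow> (\<exists>t\<le>T. (ram_step P inp ^^ t) cf = cf')"

lemma reaches_refl: "reaches P inp T cf cf"
  unfolding reaches_def by (rule exI[of _ 0]) simp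

lemma reaches_trans:
  assumes "reaches P inp T cf cf'" "reaches P inp T' cf' cf''"
  shows "reaches P inp (T + T') cf cf''"
proof -
  from assms obtain t t' where "t \<le> T" "(ram_step P inp ^^ t) cf = cf'"
    "t' \<le> T'" "(ram_step P inp ^^ t') cf' = cf''" unfolding reaches_def by blast
  then have "t' + t \<le> T + T'" "(ram_step P inp ^^ (t' + t)) cf = cf''"
    by (simp_all add: funpow_add)
  then show ?thesis unfolding reaches_def by blast
qed

lemma reaches_mono: "reaches P inp T cf cf' \<Longrightarrow> T \<le> T' \<Longrightarrow> reaches P inp T' cf cf'"
  unfolding reaches_def using order_trans by blast

lemma reaches_step:
  assumes "p < length P" "exec_instr inp (P ! p) (p, M) = cf" "reaches P inp T cf cf'"
  shows "reaches P inp (Suc T) (p, M) cf'"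
proof -
  have "reaches P inp 1 (p, M) cf"
    unfolding reaches_def by (rule exI[of _ 1]) (use assms(1,2) in \<open>simp add: ram_step_def\<close>)
  from reaches_trans[OF this assms(3)] show ?thesis by simp
qed

text \<open>Registers above \<open>d\<close> are scratch space and may end with any contents; those
  below survive, so that subexpressions can be evaluated one after another into consecutive
  registers.\<close>

definition computes ::
    "instr list \<Rightarrow> nat list \<Rightarrow> nat \<Rightarrow> nat \<Rightarrow> nat \<Rightarrow> (nat \<Rightarrow> nat) \<Rightarrow> nat \<Rightarrow> nat \<Rightarrow> bool" where
  "computes P inp T p p' M d v \<longleftrightarrow>
    (\<exists>M'. reaches P inp T (p, M) (p', M') \<and> M' d = v \<and> (\<forall>x<d. M' x = M x))"

text \<open>Variables are read from registers below \<open>d\<close> only. Code for earlier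
  subexpressions preserves these, so \<open>map M rs = env\<close> holds again wherever the next
  subexpression starts.\<close>

lemma code_correct:
  assumes "code_at P p (code p rs d e)" "\<forall>r\<in>set rs. r < d" "map M rs = env" "bnd inp N env e"
  shows "computes P inp (time_bound N e) p (p + length (code p rs d e)) M d (eval inp env e)"
  using assms
proof (induction e arbitrary: p rs d M env)
  case (Var i)
  let ?M = "M(d := eval inp env (Var i))"
  have "reaches P inp (Suc (Suc 0)) (p, M) (p + length (code p rs d (Var i)), ?M)"
  proof (cases "i < length rs")
    case True
    \<comment> \<open>Register \<open>d\<close> is cleared before \<open>rs ! i\<close> is added, so
      the two must be different.\<close>
    then have "rs ! i \<noteq> d" "M (rs ! i) = env ! i" using Var.prems by auto
    moreover have "reaches P inp (Suc (Suc 0)) (p, M)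
        (Suc (Suc p), M(d := if rs ! i = d then 0 else M (rs ! i)))"
      by (rule reaches_step, use Var.prems(1) True in simp, use Var.prems(1) True in simp)+
        (rule reaches_refl)
    ultimately show ?thesis using True Var.prems(3) by auto
  next
    case False
    have "reaches P inp (Suc (Suc 0)) (p, M) (Suc p, M(d := 0))"
      by (rule reaches_step, use Var.prems(1) False in simp, use Var.prems(1) False in simp)
        (rule reaches_refl)
    then show ?thesis using False Var.prems(3) by auto
  qed
  then show ?case by (auto simp: computes_def numeral_2_eq_2)
next
  case (Const c)
  have "reaches P inp (Suc 0) (p, M) (Suc p, M(d := c))"
    by (rule reaches_step) (use Const.prems(1) in \<open>auto intro: reaches_refl\<close>)
  then show ?case by (auto simp: computes_def)
next
  case (Plus a b)
  let ?c1 = "code p rs d a" and ?p1 = "p + length (code p rs d a)"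
  let ?c2 = "code ?p1 rs (Suc d) b"
  have at: "code_at P p ?c1" "code_at P ?p1 ?c2"
    "?p1 + length ?c2 < length P" "P ! (?p1 + length ?c2) = Add d d (Suc d)"
    using Plus.prems(1) by (simp_all add: Let_def add.assoc)
  obtain M1 where M1: "reaches P inp (time_bound N a) (p, M) (?p1, M1)"
    "M1 d = eval inp env a" "\<And>x. x < d \<Longrightarrow> M1 x = M x"
    using Plus.IH(1)[OF at(1) Plus.prems(2,3)] Plus.prems(4) by (auto simp: computes_def less_SucI)
  have env: "map M1 rs = env" and rs: "\<forall>r\<in>set rs. r < Suc d"
    using M1(3) Plus.prems(2,3) by auto
  obtain M2 where M2: "reaches P inp (time_bound N b) (?p1, M1) (?p1 + length ?c2, M2)"
    "M2 (Suc d) = eval inp env b" "\<And>x. x < Suc d \<Longrightarrow> M2 x = M1 x"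
    using Plus.IH(2)[OF at(2) rs env] Plus.prems(4) by (auto simp: computes_def less_SucI)
  have "reaches P inp (Suc 0) (?p1 + length ?c2, M2)
      (Suc (?p1 + length ?c2), M2(d := M2 d + M2 (Suc d)))"
    by (rule reaches_step[OF at(3)]) (use at(4) in \<open>auto intro: reaches_refl\<close>)
  from reaches_trans[OF reaches_trans[OF M1(1) M2(1)] this] show ?case
    unfolding computes_def using M1 M2 by (auto simp: Let_def add.assoc)
next
  case (Minus a b)
  let ?c1 = "code p rs d a" and ?p1 = "p + length (code p rs d a)"
  let ?c2 = "code ?p1 rs (Suc d) b"
  have at: "code_at P p ?c1" "code_at P ?p1 ?c2"
    "?p1 + length ?c2 < length P" "P ! (?p1 + length ?c2) = Sub d d (Suc d)"
    using Minus.prems(1) by (simp_all add: Let_def add.assoc)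
  obtain M1 where M1: "reaches P inp (time_bound N a) (p, M) (?p1, M1)"
    "M1 d = eval inp env a" "\<And>x. x < d \<Longrightarrow> M1 x = M x"
    using Minus.IH(1)[OF at(1) Minus.prems(2,3)] Minus.prems(4) by (auto simp: computes_def less_SucI)
  have env: "map M1 rs = env" and rs: "\<forall>r\<in>set rs. r < Suc d"
    using M1(3) Minus.prems(2,3) by auto
  obtain M2 where M2: "reaches P inp (time_bound N b) (?p1, M1) (?p1 + length ?c2, M2)"
    "M2 (Suc d) = eval inp env b" "\<And>x. x < Suc d \<Longrightarrow> M2 x = M1 x"
    using Minus.IH(2)[OF at(2) rs env] Minus.prems(4) by (auto simp: computes_def less_SucI)
  have "reaches P inp (Suc 0) (?p1 + length ?c2, M2)
      (Suc (?p1 + length ?c2), M2(d := M2 d - M2 (Suc d)))"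
    by (rule reaches_step[OF at(3)]) (use at(4) in \<open>auto intro: reaches_refl\<close>)
  from reaches_trans[OF reaches_trans[OF M1(1) M2(1)] this] show ?case
    unfolding computes_def using M1 M2 by (auto simp: Let_def add.assoc)
next
  case (Inp a)
  let ?p1 = "p + length (code p rs d a)"
  have at: "code_at P p (code p rs d a)" "?p1 < length P" "P ! ?p1 = Read d d"
    using Inp.prems(1) by simp_all
  obtain M1 where M1: "reaches P inp (time_bound N a) (p, M) (?p1, M1)"
    "M1 d = eval inp env a" "\<And>x. x < d \<Longrightarrow> M1 x = M x"
    using Inp.IH[OF at(1) Inp.prems(2,3)] Inp.prems(4) by (auto simp: computes_def less_SucI)
  have "reaches P inp (Suc 0) (?p1, M1) (Suc ?p1, M1(d := rd inp (M1 d)))"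
    by (rule reaches_step[OF at(2)]) (use at(3) in \<open>auto simp: rd_def intro: reaches_refl\<close>)
  from reaches_trans[OF M1(1) this] show ?case
    unfolding computes_def using M1 by auto
next
  case (IfZero c a b)
  let ?c1 = "code p rs d c" and ?p1 = "p + length (code p rs d c)"
  let ?c2 = "code (Suc ?p1) rs d b"
  let ?l = "Suc (Suc (?p1 + length ?c2))"
  let ?c3 = "code ?l rs d a"
  have at: "code_at P p ?c1" "?p1 < length P" "P ! ?p1 = JumpZero d ?l"
    "code_at P (Suc ?p1) ?c2" "Suc (?p1 + length ?c2) < length P"
    "P ! Suc (?p1 + length ?c2) = Jump (?l + length ?c3)" "code_at P ?l ?c3"
    using IfZero.prems(1) by (simp_all add: Let_def add.assoc)
  have len: "p + length (code p rs d (IfZero c a b)) = ?l + length ?c3"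
    by (simp add: Let_def)
  obtain M1 where M1: "reaches P inp (time_bound N c) (p, M) (?p1, M1)"
    "M1 d = eval inp env c" "\<And>x. x < d \<Longrightarrow> M1 x = M x"
    using IfZero.IH(1)[OF at(1) IfZero.prems(2,3)] IfZero.prems(4) by (auto simp: computes_def less_SucI)
  have env: "map M1 rs = env" using M1(3) IfZero.prems(2,3) by auto
  show ?case
  proof (cases "eval inp env c = 0")
    case True
    have 1: "reaches P inp (Suc 0) (?p1, M1) (?l, M1)"
      by (rule reaches_step[OF at(2)]) (use at(3) M1(2) True in \<open>auto intro: reaches_refl\<close>)
    obtain M2 where M2: "reaches P inp (time_bound N a) (?l, M1) (?l + length ?c3, M2)"
      "M2 d = eval inp env a" "\<And>x. x < d \<Longrightarrow> M2 x = M1 x"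
      using IfZero.IH(2)[OF at(7) IfZero.prems(2) env] IfZero.prems(4) True by (auto simp: computes_def less_SucI)
    have "reaches P inp (time_bound N (IfZero c a b)) (p, M) (?l + length ?c3, M2)"
      by (rule reaches_mono[OF reaches_trans[OF reaches_trans[OF M1(1) 1] M2(1)]]) simp
    then show ?thesis unfolding computes_def len using M1 M2 True by auto
  next
    case False
    have 1: "reaches P inp (Suc 0) (?p1, M1) (Suc ?p1, M1)"
      by (rule reaches_step[OF at(2)]) (use at(3) M1(2) False in \<open>auto intro: reaches_refl\<close>)
    obtain M2 where M2: "reaches P inp (time_bound N b) (Suc ?p1, M1) (Suc ?p1 + length ?c2, M2)"
      "M2 d = eval inp env b" "\<And>x. x < d \<Longrightarrow> M2 x = M1 x"
      using IfZero.IH(3)[OF at(4) IfZero.prems(2) env] IfZero.prems(4) False by (auto simp: computes_def less_SucI)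
    have 2: "reaches P inp (Suc 0) (Suc ?p1 + length ?c2, M2) (?l + length ?c3, M2)"
      by (rule reaches_step) (use at(5,6) in \<open>auto intro: reaches_refl\<close>)
    have "reaches P inp (time_bound N (IfZero c a b)) (p, M) (?l + length ?c3, M2)"
      by (rule reaches_mono[OF reaches_trans[OF reaches_trans[OF reaches_trans[OF M1(1) 1] M2(1)] 2]]) simp
    then show ?thesis unfolding computes_def len using M1 M2 False by auto
  qed
next
  \<comment> \<open>Register \<open>d\<close> holds the accumulator, \<open>Suc d\<close> the number
    of rounds still to go and \<open>d + 2\<close> the counter; the body leaves its value in
    \<open>d + 3\<close>. The loop test is at \<open>?l\<close>, and \<open>?q\<close> is the
    address behind the body.\<close>
  case (Iter n i s)
  let ?c1 = "code p rs d i" and ?p1 = "p + length (code p rs d i)"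
  let ?c2 = "code ?p1 rs (Suc d) n"
  let ?l = "Suc (?p1 + length ?c2)"
  let ?rs = "rs @ [d + 2, d]"
  let ?c3 = "code (Suc ?l) ?rs (d + 3) s"
  let ?q = "Suc ?l + length ?c3"
  let ?acc = "rec_nat (eval inp env i) (\<lambda>j a. eval inp (env @ [j, a]) s)"
  let ?n = "eval inp env n"
  have at: "code_at P p ?c1" "code_at P ?p1 ?c2"
    "?p1 + length ?c2 < length P" "P ! (?p1 + length ?c2) = SetConst (d + 2) 0"
    "?l < length P" "P ! ?l = JumpZero (Suc d) (?l + length ?c3 + 7)"
    "code_at P (Suc ?l) ?c3"
    "code_at P ?q [SetConst d 0, Add d d (d + 3), SetConst (d + 3) 1,
      Add (d + 2) (d + 2) (d + 3), Sub (Suc d) (Suc d) (d + 3), Jump ?l]"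
    using Iter.prems(1) by (simp_all add: Let_def add.assoc)
  have len: "p + length (code p rs d (Iter n i s)) = ?l + length ?c3 + 7"
    by (simp add: Let_def)
  obtain M1 where M1: "reaches P inp (time_bound N i) (p, M) (?p1, M1)"
    "M1 d = eval inp env i" "\<And>x. x < d \<Longrightarrow> M1 x = M x"
    using Iter.IH(2)[OF at(1) Iter.prems(2,3)] Iter.prems(4) by (auto simp: computes_def less_SucI)
  have env: "map M1 rs = env" and rs: "\<forall>r\<in>set rs. r < Suc d"
    using M1(3) Iter.prems(2,3) by auto
  obtain M2 where M2: "reaches P inp (time_bound N n) (?p1, M1) (?p1 + length ?c2, M2)"
    "M2 (Suc d) = ?n" "\<And>x. x < Suc d \<Longrightarrow> M2 x = M1 x"
    using Iter.IH(1)[OF at(2) rs env] Iter.prems(4) by (auto simp: computes_def less_SucI)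
  have body: "\<exists>M''. reaches P inp (time_bound N s + 7) (?l, M') (?l, M'') \<and> M'' d = ?acc (Suc j) \<and>
      M'' (Suc d) = ?n - Suc j \<and> M'' (d + 2) = Suc j \<and> (\<forall>x<d. M'' x = M x)"
    if j: "j < ?n" and M': "M' d = ?acc j" "M' (Suc d) = ?n - j" "M' (d + 2) = j" "\<forall>x<d. M' x = M x"
    for j M'
  proof -
    have 1: "reaches P inp (Suc 0) (?l, M') (Suc ?l, M')"
      by (rule reaches_step[OF at(5)]) (use at(6) M'(2) j in \<open>auto intro: reaches_refl\<close>)
    have env: "map M' ?rs = env @ [j, ?acc j]" using M' Iter.prems(2,3) by auto
    have "bnd inp N (env @ [j, ?acc j]) s" using Iter.prems(4) j by simp
    moreover have rs: "\<forall>r\<in>set ?rs. r < d + 3" using Iter.prems(2) by auto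
    ultimately obtain M3 where M3: "reaches P inp (time_bound N s) (Suc ?l, M') (?q, M3)"
      "M3 (d + 3) = ?acc (Suc j)" "\<And>x. x < d + 3 \<Longrightarrow> M3 x = M' x"
      using Iter.IH(3)[OF at(7) rs env] by (auto simp: computes_def less_SucI)
    \<comment> \<open>After the value has been moved to \<open>d\<close>, register
      \<open>d + 3\<close> serves as the constant 1 by which the counter grows and the remaining
      number shrinks.\<close>
    let ?M = "M3(d := ?acc (Suc j), d + 3 := 1, d + 2 := Suc j, Suc d := ?n - Suc j)"
    have "reaches P inp (Suc (Suc (Suc (Suc (Suc (Suc 0)))))) (?q, M3) (?l, ?M)"
      by (rule reaches_step, use at(8) in simp, use at(8) in simp)+
        (use M3 M' in \<open>auto simp: fun_eq_iff intro!: reaches_refl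
          arg_cong2[where f="\<lambda>c c'. reaches P inp 0 (?l, c) (?l, c')", THEN iffD2, OF _ refl]\<close>)
    from reaches_trans[OF reaches_trans[OF 1 M3(1)] this]
    have "reaches P inp (time_bound N s + 7) (?l, M') (?l, ?M)" by (rule reaches_mono) simp
    then show ?thesis using M3(3) M'(4) by (intro exI[of _ ?M]) auto
  qed
  have loop: "\<exists>M'. reaches P inp (j * (time_bound N s + 7)) (?l, M2(d + 2 := 0)) (?l, M') \<and>
      M' d = ?acc j \<and> M' (Suc d) = ?n - j \<and> M' (d + 2) = j \<and> (\<forall>x<d. M' x = M x)"
    if "j \<le> ?n" for j
    using that
  proof (induction j)
    case 0
    show ?case using M1 M2 by (intro exI[of _ "M2(d + 2 := 0)"]) (auto intro: reaches_refl)
  next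
    case (Suc j)
    then have "j \<le> ?n" by simp
    from Suc.IH[OF this] obtain M' where M': "reaches P inp (j * (time_bound N s + 7)) (?l, M2(d + 2 := 0)) (?l, M')"
      "M' d = ?acc j" "M' (Suc d) = ?n - j" "M' (d + 2) = j" "\<forall>x<d. M' x = M x" by blast
    from Suc.prems have "j < ?n" by simp
    from body[OF this M'(2-5)] obtain M'' where
      M'': "reaches P inp (time_bound N s + 7) (?l, M') (?l, M'')" "M'' d = ?acc (Suc j)"
      "M'' (Suc d) = ?n - Suc j" "M'' (d + 2) = Suc j" "\<forall>x<d. M'' x = M x" by blast
    have mult: "j * (time_bound N s + 7) + (time_bound N s + 7) = Suc j * (time_bound N s + 7)"
      by simp
    from reaches_trans[OF M'(1) M''(1)] M''(2-) show ?case unfolding mult by blast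
  qed
  obtain M3 where M3: "reaches P inp (?n * (time_bound N s + 7)) (?l, M2(d + 2 := 0)) (?l, M3)"
    "M3 d = ?acc ?n" "M3 (Suc d) = 0" "\<forall>x<d. M3 x = M x" using loop[of ?n] by auto
  have 1: "reaches P inp (Suc 0) (?p1 + length ?c2, M2) (?l, M2(d + 2 := 0))"
    by (rule reaches_step[OF at(3)]) (use at(4) in \<open>auto intro: reaches_refl\<close>)
  have 2: "reaches P inp (Suc 0) (?l, M3) (?l + length ?c3 + 7, M3)"
    by (rule reaches_step[OF at(5)]) (use at(6) M3 in \<open>auto intro: reaches_refl\<close>)
  have "?n * (time_bound N s + 7) \<le> N * (time_bound N s + 7)"
    using Iter.prems(4) by (intro mult_le_mono1) simp
  then have "reaches P inp (time_bound N (Iter n i s)) (p, M) (?l + length ?c3 + 7, M3)"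
    by (intro reaches_mono[OF reaches_trans[OF reaches_trans[OF reaches_trans[OF reaches_trans[OF
      M1(1) M2(1)] 1] M3(1)] 2]]) simp
  then show ?case unfolding computes_def len using M3 by auto
next
  case (App f es)
  \<comment> \<open>Target register, memory and remaining arguments are generalized, as each
    argument moves the target one register up.\<close>
  have args: "\<exists>M'. reaches P inp (\<Sum>e\<leftarrow>es'. time_bound N e) (q, M1) (q + length (codes q rs d' es'), M') \<and>
      map M' [d'..<d' + length es'] = map (eval inp env) es' \<and> (\<forall>x<d'. M' x = M1 x)"
    if "code_at P q (codes q rs d' es')" "d \<le> d'" "\<forall>x<d. M1 x = M x" "set es' \<subseteq> set es" for q d' M1 es'
    using that
  proof (induction es' arbitrary: q d' M1)
    case Nil
    then show ?case by (auto intro: reaches_refl)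
  next
    case (Cons e es')
    let ?q = "q + length (code q rs d' e)"
    have at: "code_at P q (code q rs d' e)" "code_at P ?q (codes ?q rs (Suc d') es')"
      using Cons.prems(1) by (simp_all add: Let_def)
    have env: "map M1 rs = env" and rs: "\<forall>r\<in>set rs. r < d'"
      using Cons.prems(2,3) App.prems(2,3) by auto
    have "e \<in> set es" "bnd inp N env e" using Cons.prems(4) App.prems(4) by auto
    then obtain M2 where M2: "reaches P inp (time_bound N e) (q, M1) (?q, M2)"
      "M2 d' = eval inp env e" "\<And>x. x < d' \<Longrightarrow> M2 x = M1 x"
      using App.IH(2)[OF _ at(1) rs env] by (auto simp: computes_def)
    obtain M3 where M3: "reaches P inp (\<Sum>e\<leftarrow>es'. time_bound N e) (?q, M2)
        (?q + length (codes ?q rs (Suc d') es'), M3)"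
      "map M3 [Suc d'..<Suc d' + length es'] = map (eval inp env) es'" "\<forall>x<Suc d'. M3 x = M2 x"
      using Cons.IH[OF at(2), of M2] Cons.prems M2(3) by auto
    have "[d'..<d' + length (e # es')] = d' # [Suc d'..<Suc d' + length es']"
      by (simp add: upt_conv_Cons del: upt_Suc)
    then have "map M3 [d'..<d' + length (e # es')] = map (eval inp env) (e # es')"
      using M3(2,3) M2(2) by (simp del: upt_Suc)
    with reaches_trans[OF M2(1) M3(1)] M3(3) M2(3) show ?case
      by (intro exI[of _ M3]) (auto simp: Let_def add.assoc)
  qed
  let ?c1 = "codes p rs (Suc d) es" and ?p1 = "p + length (codes p rs (Suc d) es)"
  let ?d = "Suc d + length es"
  let ?c2 = "code ?p1 [Suc d..<?d] ?d f"
  let ?q = "?p1 + length ?c2"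
  have at: "code_at P p ?c1" "code_at P ?p1 ?c2" "code_at P ?q [SetConst d 0, Add d d ?d]"
    using App.prems(1) by (simp_all add: Let_def add.assoc del: code_at_Cons)
  obtain M1 where M1: "reaches P inp (\<Sum>e\<leftarrow>es. time_bound N e) (p, M) (?p1, M1)"
    "map M1 [Suc d..<?d] = map (eval inp env) es" "\<forall>x<Suc d. M1 x = M x"
    using args[OF at(1)] by auto
  have rs: "\<forall>r\<in>set [Suc d..<?d]. r < ?d" by auto
  obtain M2 where M2: "reaches P inp (time_bound N f) (?p1, M1) (?q, M2)"
    "M2 ?d = eval inp env (App f es)" "\<And>x. x < ?d \<Longrightarrow> M2 x = M1 x"
    using App.IH(1)[OF at(2) rs M1(2)] App.prems(4)
    by (auto simp: computes_def simp del: upt_Suc)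
  have "reaches P inp (Suc (Suc 0)) (?q, M2) (Suc (Suc ?q), M2(d := M2 ?d))"
    by (rule reaches_step, use at(3) in simp, use at(3) in simp)+ (auto intro: reaches_refl)
  from reaches_trans[OF reaches_trans[OF M1(1) M2(1)] this]
  have "reaches P inp (time_bound N (App f es)) (p, M) (Suc (Suc ?q), M2(d := M2 ?d))"
    by (rule reaches_mono) simp
  moreover have len: "p + length (code p rs d (App f es)) = Suc (Suc ?q)" by (simp add: Let_def)
  moreover have "(M2(d := M2 ?d)) d = eval inp env (App f es)" using M2(2) by (simp del: eval.simps)
  moreover have "\<forall>x<d. (M2(d := M2 ?d)) x = M x" using M2(3) M1(3) by simp
  ultimately show ?case unfolding computes_def len by blast
qed

lemma ram_step_halted: "length P \<le> fst cf \<Longrightarrow> (ram_step P inp ^^ t) cf = cf"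
  by (induction t) (auto simp: ram_step_def)

text \<open>The code may end early, but a halted configuration is a fixed point, so continuing to
  exactly \<open>T\<close> steps changes nothing.\<close>

lemma ram_outputs_eval:
  assumes "bnd inp N [] e" "time_bound N e \<le> T"
  shows "ram_outputs_within (code 0 [] 0 e) inp T (eval inp [] e)"
proof -
  let ?P = "code 0 [] 0 e"
  have "computes ?P inp (time_bound N e) 0 (0 + length ?P) (\<lambda>_. 0) 0 (eval inp [] e)"
    by (rule code_correct) (use assms in \<open>auto simp: code_at_def\<close>)
  then obtain t M where t: "t \<le> T" "(ram_step ?P inp ^^ t) (0, \<lambda>_. 0) = (length ?P, M)"
    "M 0 = eval inp [] e"
    using assms(2) unfolding reaches_def computes_def by (metis add_0 order_trans)
  have "(ram_step ?P inp ^^ T) (0, \<lambda>_. 0) = (ram_step ?P inp ^^ (T - t)) (length ?P, M)"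
    using t(1,2) funpow_add[of "T - t" t "ram_step ?P inp"] by simp
  then show ?thesis using t(3) by (simp add: ram_step_halted ram_outputs_within_def)
qed

lemma ram_computable_eval: "ram_computable (\<lambda>k. eval [k] [] e)"
proof -
  have "\<exists>t. ram_outputs_within (code 0 [] 0 e) [k] t (eval [k] [] e)" for k
    using ex_bnd[of "[k]" "[]" e] ram_outputs_eval by blast
  then show ?thesis unfolding ram_computable_def by blast
qed


section \<open>Strategies of the universal player\<close>

text \<open>
  The number \<open>A\<close> encodes the existential moves in mixed radix. If \<open>P\<close> is the product of the
  sizes of the existential domains passed so far, then \<open>A mod P\<close> encodes the moves made so far;
  a strategy \<open>\<sigma>\<close> sees the position \<open>i\<close> and this number.
\<close>

fun play :: "(nat \<Rightarrow> nat \<Rightarrow> nat) \<Rightarrow> nat \<Rightarrow> nat \<Rightarrow> nat \<Rightarrow> (quantifier \<times> nat list) list \<Rightarrow> nat list" where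
  "play \<sigma> A i P [] = []"
| "play \<sigma> A i P ((Exists, D) # Q) =
    D ! (A div P mod length D) # play \<sigma> A (Suc i) (P * length D) Q"
| "play \<sigma> A i P ((Forall, D) # Q) =
    D ! (\<sigma> i (A mod P) mod length D) # play \<sigma> A (Suc i) P Q"

text \<open>The number of plays against a fixed strategy.\<close>

definition num_leaves :: "(quantifier \<times> nat list) list \<Rightarrow> nat" where
  "num_leaves Q = (\<Prod>(q, D)\<leftarrow>Q. if q = Exists then length D else 1)"

lemma num_leaves_simps [simp]:
  "num_leaves [] = 1"
  "num_leaves ((Exists, D) # Q) = length D * num_leaves Q"
  "num_leaves ((Forall, D) # Q) = num_leaves Q"
  by (simp_all add: num_leaves_def)

lemma length_play [simp]: "length (play \<sigma> A i P Q) = length Q"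
  by (induction \<sigma> A i P Q rule: play.induct) auto

text \<open>A closed form without recursion along the prefix, so that the algorithm can compute the
  value of a single variable whenever it is needed.\<close>

lemma play_nth:
  assumes "j < length Q"
  shows "play \<sigma> A i P Q ! j =
    (let D = snd (Q ! j); P' = P * num_leaves (take j Q)
     in D ! ((if fst (Q ! j) = Exists then A div P' else \<sigma> (i + j) (A mod P')) mod length D))"
  using assms
proof (induction \<sigma> A i P Q arbitrary: j rule: play.induct)
  case (2 \<sigma> A i P D Q)
  then show ?case by (cases j) (auto simp: Let_def mult.assoc)
next
  case (3 \<sigma> A i P D Q)
  then show ?case by (cases j) (auto simp: Let_def)
qed simp

text \<open>All later radix products are multiples of \<open>P\<close>, so the strategy is consulted
  only at numbers that agree with \<open>A\<close> modulo \<open>P\<close>, and only from position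
  \<open>i\<close> on.\<close>

lemma play_cong:
  assumes "\<And>j x. i \<le> j \<Longrightarrow> x mod P = A mod P \<Longrightarrow> \<sigma> j x = \<sigma>' j x"
  shows "play \<sigma> A i P Q = play \<sigma>' A i P Q"
  using assms
proof (induction \<sigma> A i P Q rule: play.induct)
  case (2 \<sigma> A i P D Q)
  have "\<sigma> j x = \<sigma>' j x" if "Suc i \<le> j" "x mod (P * length D) = A mod (P * length D)" for j x
  proof -
    have "x mod P = A mod P" using that(2) by (metis dvd_triv_left mod_mod_cancel)
    with that(1) show ?thesis by (intro 2(2)) auto
  qed
  from 2(1)[OF this] show ?case by simp
next
  case (3 \<sigma> A i P D Q)
  have "\<sigma> j x = \<sigma>' j x" if "Suc i \<le> j" "x mod P = A mod P" for j x
    using that by (intro 3(2)) auto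
  from 3(1)[OF this] 3(2)[of i "A mod P"] show ?case by simp
qed simp

text \<open>A witness \<open>D ! k\<close> of an existential quantifier is recorded as the next
  mixed-radix digit, which turns the code \<open>c\<close> into \<open>c + P * k\<close>. Universal
  moves come from the strategy and leave the code unchanged.\<close>

lemma qtrue_beats:
  assumes "qtrue Q \<alpha> Cs" "c < P" "\<forall>(q, D)\<in>set Q. D \<noteq> []"
  shows "\<exists>A<P * num_leaves Q. A mod P = c \<and> (\<forall>C\<in>set Cs. satisfies (\<alpha> @ play \<sigma> A i P Q) C)"
  using assms
proof (induction Q \<alpha> Cs arbitrary: c P i rule: qtrue.induct)
  case (1 \<alpha> Cs)
  then show ?case by (intro exI[of _ c]) auto
next
  case (2 D Q \<alpha> Cs)
  then obtain k where k: "k < length D" "qtrue Q (\<alpha> @ [D ! k]) Cs" by (auto simp: in_set_conv_nth)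
  have "c + P * k < P * length D"
  proof -
    have "c + P * k < P * Suc k" using 2(3) by simp
    also have "\<dots> \<le> P * length D" using k(1) by (intro mult_le_mono2) simp
    finally show ?thesis .
  qed
  moreover have "\<forall>(q, D)\<in>set Q. D \<noteq> []" using 2(4) by simp
  ultimately obtain A where A:
    "A < P * length D * num_leaves Q" "A mod (P * length D) = c + P * k"
    "\<forall>C\<in>set Cs. satisfies ((\<alpha> @ [D ! k]) @ play \<sigma> A (Suc i) (P * length D) Q) C"
    using 2(1)[OF nth_mem[OF k(1)] k(2), of "c + P * k" "P * length D" "Suc i"] by blast
  have "A mod P = A mod (P * length D) mod P" by (simp add: mod_mod_cancel)
  also have "\<dots> = c" using A(2) 2(3) by simp
  finally have "A mod P = c" .
  moreover from this have "A div P mod length D = k" using A(2) 2(3) by (simp add: mod_mult2_eq)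
  ultimately show ?case using A(1,3) by (auto simp: mult.assoc intro!: exI[of _ A])
next
  case (3 D Q \<alpha> Cs)
  let ?v = "D ! (\<sigma> i c mod length D)"
  have v: "?v \<in> set D" using 3(4) by simp
  then have "qtrue Q (\<alpha> @ [?v]) Cs" using 3(2) by simp
  moreover have "\<forall>(q, D)\<in>set Q. D \<noteq> []" using 3(4) by simp
  ultimately obtain A where A: "A < P * num_leaves Q" "A mod P = c"
    "\<forall>C\<in>set Cs. satisfies ((\<alpha> @ [?v]) @ play \<sigma> A (Suc i) P Q) C"
    using 3(1)[OF v, of c P "Suc i"] 3(3) by blast
  then show ?case by (auto intro!: exI[of _ A])
qed

text \<open>One strategy function must serve all existential branches. It can, because the number it
  sees reveals which branch was taken. A universal move is entered at its own position, which later
  moves never consult.\<close>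

lemma not_qtrue_strategy:
  assumes "\<not> qtrue Q \<alpha> Cs" "c < P" "\<forall>(q, D)\<in>set Q. D \<noteq> []"
  shows "\<exists>\<sigma>. \<forall>A. A mod P = c \<longrightarrow> (\<exists>C\<in>set Cs. \<not> satisfies (\<alpha> @ play \<sigma> A i P Q) C)"
  using assms
proof (induction Q \<alpha> Cs arbitrary: c P i rule: qtrue.induct)
  case (1 \<alpha> Cs)
  then show ?case by auto
next
  case (2 D Q \<alpha> Cs)
  have "\<exists>\<sigma>. \<forall>A. A mod (P * length D) = c + P * k \<longrightarrow>
      (\<exists>C\<in>set Cs. \<not> satisfies ((\<alpha> @ [D ! k]) @ play \<sigma> A (Suc i) (P * length D) Q) C)"
    if k: "k < length D" for k
  proof (rule 2(1)[OF nth_mem[OF k]])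
    show "\<not> qtrue Q (\<alpha> @ [D ! k]) Cs" using 2(2) k by auto
    have "c + P * k < P * Suc k" using 2(3) by simp
    also have "\<dots> \<le> P * length D" using k by (intro mult_le_mono2) simp
    finally show "c + P * k < P * length D" .
  qed (use 2(4) in auto)
  then obtain S where S: "\<And>k A. k < length D \<Longrightarrow> A mod (P * length D) = c + P * k \<Longrightarrow>
      \<exists>C\<in>set Cs. \<not> satisfies ((\<alpha> @ [D ! k]) @ play (S k) A (Suc i) (P * length D) Q) C"
    by metis
  \<comment> \<open>The digit at radix weight \<open>P\<close> is the choice made here, and it
    selects the strategy of that branch.\<close>
  let ?\<sigma> = "\<lambda>j x. S (x div P mod length D) j x"
  have "\<exists>C\<in>set Cs. \<not> satisfies (\<alpha> @ play ?\<sigma> A i P ((Exists, D) # Q)) C" if A: "A mod P = c" for A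
  proof -
    let ?k = "A div P mod length D"
    have k: "?k < length D" using 2(4) by simp
    have "play ?\<sigma> A (Suc i) (P * length D) Q = play (S ?k) A (Suc i) (P * length D) Q"
    proof (rule play_cong)
      fix j x assume eq: "x mod (P * length D) = A mod (P * length D)"
      then have "x mod P = A mod P" by (metis dvd_triv_left mod_mod_cancel)
      with eq 2(3) have "x div P mod length D = ?k" by (simp add: mod_mult2_eq)
      then show "?\<sigma> j x = S ?k j x" by simp
    qed
    moreover have "A mod (P * length D) = c + P * ?k" using A by (simp add: mod_mult2_eq)
    ultimately show ?thesis using S[OF k] by simp
  qed
  then show ?case by blast
next
  case (3 D Q \<alpha> Cs)
  then obtain k where k: "k < length D" "\<not> qtrue Q (\<alpha> @ [D ! k]) Cs" by (auto simp: in_set_conv_nth)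
  have "\<forall>(q, D)\<in>set Q. D \<noteq> []" using 3(4) by simp
  from 3(1)[OF nth_mem[OF k(1)] k(2) 3(3) this, of "Suc i"] obtain \<sigma> where
    \<sigma>: "\<forall>A. A mod P = c \<longrightarrow> (\<exists>C\<in>set Cs. \<not> satisfies ((\<alpha> @ [D ! k]) @ play \<sigma> A (Suc i) P Q) C)"
    by blast
  let ?\<sigma> = "\<sigma>(i := \<lambda>_. k)"
  have "play ?\<sigma> A (Suc i) P Q = play \<sigma> A (Suc i) P Q" for A
    by (rule play_cong) auto
  then have "play ?\<sigma> A i P ((Forall, D) # Q) = D ! k # play \<sigma> A (Suc i) P Q" for A
    using k(1) by simp
  then have "\<forall>A. A mod P = c \<longrightarrow>
      (\<exists>C\<in>set Cs. \<not> satisfies (\<alpha> @ play ?\<sigma> A i P ((Forall, D) # Q)) C)"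
    using \<sigma> by (simp del: play.simps)
  then show ?case by blast
qed

text \<open>Quantification over the first empty domain has a truth value independent of the
  constraints, and the nonempty domains before it pass this value on.\<close>

lemma qtrue_empty_domain:
  assumes "\<exists>i<length Q. snd (Q ! i) = []"
  shows "qtrue Q \<alpha> Cs \<longleftrightarrow> fst (Q ! (LEAST i. snd (Q ! i) = [])) = Forall"
  using assms
proof (induction Q \<alpha> Cs rule: qtrue.induct)
  case (2 D Q \<alpha> Cs)
  show ?case
  proof (cases "D = []")
    case True
    then have "(LEAST i. snd (((Exists, D) # Q) ! i) = []) = 0" by (intro Least_equality) auto
    then show ?thesis using True by simp
  next
    case False
    with 2(2) obtain i where i: "i < length Q" "snd (Q ! i) = []" by (auto simp: less_Suc_eq_0_disj)
    then have "(LEAST i. snd (((Exists, D) # Q) ! i) = []) = Suc (LEAST i. snd (Q ! i) = [])"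
      by (subst Least_Suc[of _ "Suc i"]) (use False in auto)
    moreover have "qtrue Q (\<alpha> @ [v]) Cs \<longleftrightarrow> fst (Q ! (LEAST i. snd (Q ! i) = [])) = Forall"
      if "v \<in> set D" for v using 2(1)[OF that] i by blast
    moreover obtain v where "v \<in> set D" using False by (cases D) auto
    ultimately show ?thesis by auto
  qed
next
  case (3 D Q \<alpha> Cs)
  show ?case
  proof (cases "D = []")
    case True
    then have "(LEAST i. snd (((Forall, D) # Q) ! i) = []) = 0" by (intro Least_equality) auto
    then show ?thesis using True by simp
  next
    case False
    with 3(2) obtain i where i: "i < length Q" "snd (Q ! i) = []" by (auto simp: less_Suc_eq_0_disj)
    then have "(LEAST i. snd (((Forall, D) # Q) ! i) = []) = Suc (LEAST i. snd (Q ! i) = [])"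
      by (subst Least_Suc[of _ "Suc i"]) (use False in auto)
    moreover have "qtrue Q (\<alpha> @ [v]) Cs \<longleftrightarrow> fst (Q ! (LEAST i. snd (Q ! i) = [])) = Forall"
      if "v \<in> set D" for v using 3(1)[OF that] i by blast
    moreover obtain v where "v \<in> set D" using False by (cases D) auto
    ultimately show ?thesis by auto
  qed
qed simp


section \<open>Hashing by bit selection\<close>

text \<open>The bits of \<open>u\<close> below position \<open>m\<close> that the mask
  \<open>w\<close> selects, packed in reversed order: the highest selected bit becomes the least
  significant.\<close>

fun hash :: "nat \<Rightarrow> nat \<Rightarrow> nat \<Rightarrow> nat" where
  "hash 0 w u = 0"
| "hash (Suc m) w u =
    (if odd (w div 2 ^ m) then 2 * hash m w u + u div 2 ^ m mod 2 else hash m w u)"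

text \<open>Selecting bit \<open>m\<close> doubles the hash and adds at most 1, while the mask grows
  by \<open>2 ^ m\<close>, which exceeds the old hash. This bounds table positions even for masks
  that separate nothing.\<close>

lemma hash_le: "hash m w u \<le> w mod 2 ^ m"
proof (induction m)
  case (Suc m)
  have eq: "w mod 2 ^ Suc m = w mod 2 ^ m + 2 ^ m * (w div 2 ^ m mod 2)"
    by (metis add.commute mod_mult2_eq power_Suc2)
  have lt: "w mod 2 ^ m < (2::nat) ^ m" by simp
  show ?case
  proof (cases "odd (w div 2 ^ m)")
    case True
    have "u div 2 ^ m mod 2 < 2" by simp
    moreover have "w div 2 ^ m mod 2 = 1" using True by presburger
    moreover have "hash (Suc m) w u = 2 * hash m w u + u div 2 ^ m mod 2" using True by simp
    moreover have "w mod 2 ^ Suc m = w mod 2 ^ m + 2 ^ m" using eq calculation(2) by simp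
    ultimately show ?thesis using Suc lt by linarith
  next
    case False
    then show ?thesis using Suc eq by simp
  qed
qed simp

lemma bit_cong:
  assumes "x mod 2 ^ m = y mod 2 ^ m" "j < m"
  shows "x div 2 ^ j mod 2 = y div 2 ^ j mod (2::nat)"
proof -
  have *: "x div 2 ^ j mod 2 = x mod 2 ^ m mod 2 ^ Suc j div 2 ^ j" for x :: nat
  proof -
    have "(2::nat) ^ Suc j dvd 2 ^ m" using assms(2) by (intro le_imp_power_dvd) simp
    then have "x mod 2 ^ m mod 2 ^ Suc j = x mod (2 ^ j * 2)" by (simp add: mod_mod_cancel mult.commute)
    then show ?thesis by (simp add: mod_mult2_eq)
  qed
  show ?thesis unfolding *[of x] *[of y] assms(1) ..
qed

lemma hash_cong:
  assumes "w mod 2 ^ m = w' mod 2 ^ m" "u mod 2 ^ m = u' mod 2 ^ m"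
  shows "hash m w u = hash m w' u'"
proof -
  have "hash k w u = hash k w' u'" if "k \<le> m" for k
    using that
  proof (induction k)
    case (Suc k)
    then have "w div 2 ^ k mod 2 = w' div 2 ^ k mod 2" "u div 2 ^ k mod 2 = u' div 2 ^ k mod 2"
      using bit_cong[OF assms(1)] bit_cong[OF assms(2)] by simp_all
    moreover from this have "odd (w div 2 ^ k) = odd (w' div 2 ^ k)" by (simp only: odd_iff_mod_2_eq_one)
    ultimately show ?case using Suc by simp
  qed simp
  then show ?thesis by simp
qed

text \<open>The algorithm always hashes with \<open>2 * n\<close> bits, whereas a separating mask is
  found for some length \<open>l\<close>; the missing upper bits of the mask are zero and select
  nothing.\<close>

lemma hash_extend:
  assumes "w < 2 ^ l" "l \<le> m"
  shows "hash m w u = hash l w u"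
  using assms(2)
proof (induction m rule: dec_induct)
  case (step m)
  have "w < 2 ^ m" using assms(1) step(1) by (meson less_le_trans one_le_numeral power_increasing)
  then show ?case using step by simp
qed simp

text \<open>Discarding the top bit either keeps \<open>V\<close> apart or makes it smaller; only then the bit is selected.\<close>

lemma ex_hash_nonempty:
  assumes "V \<subseteq> {..<2 ^ l}" "V \<noteq> {}"
  shows "\<exists>w<2 ^ l. inj_on (hash l w) V \<and> (\<forall>u. hash l w u < 2 ^ (card V - 1))"
  using assms
proof (induction l arbitrary: V)
  case 0
  then have "V = {0}" by auto
  then show ?case by auto
next
  case (Suc l)
  have fin: "finite V" using Suc.prems(1) finite_subset by blast
  let ?f = "\<lambda>u. u mod 2 ^ l"
  obtain w where w: "w < 2 ^ l" "inj_on (hash l w) (?f ` V)" "\<And>u. hash l w u < 2 ^ (card (?f ` V) - 1)"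
  proof -
    have "?f ` V \<subseteq> {..<2 ^ l}" "?f ` V \<noteq> {}" using Suc.prems(2) by auto
    from Suc.IH[OF this] show thesis using that by blast
  qed
  have h: "hash l w u = hash l w (?f u)" for u by (rule hash_cong) auto
  show ?case
  proof (cases "inj_on ?f V")
    case True
    have "hash (Suc l) w u = hash l w u" for u using w(1) by simp
    then have "hash (Suc l) w = hash l w" by blast
    moreover have "inj_on (hash l w) V"
    proof -
      have "inj_on (hash l w \<circ> ?f) V" using True w(2) by (rule comp_inj_on)
      then show ?thesis using h by (simp add: inj_on_def)
    qed
    ultimately show ?thesis using w(1,3) card_image[OF True] by (intro exI[of _ w]) auto
  next
    case False
    have "card (?f ` V) < card V"
      using False fin card_image_le[OF fin, of ?f] inj_on_iff_eq_card[OF fin, of ?f] by linarith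
    moreover have "0 < card (?f ` V)" using fin Suc.prems(2) by (simp add: card_gt_0_iff)
    \<comment> \<open>A selected bit is paid for by an element lost in the image. The image is
      nonempty, so the subtraction is not truncated.\<close>
    ultimately have c: "Suc (card (?f ` V) - 1) \<le> card V - 1" by simp
    let ?w = "w + 2 ^ l"
    have hl: "hash l ?w u = hash l w (?f u)" for u by (rule hash_cong) auto
    have hS: "hash (Suc l) ?w u = 2 * hash l w (?f u) + u div 2 ^ l mod 2" for u
      using w(1) hl[of u] by simp
    have "inj_on (hash (Suc l) ?w) V"
    proof (rule inj_onI)
      fix u v assume uv: "u \<in> V" "v \<in> V" "hash (Suc l) ?w u = hash (Suc l) ?w v"
      have "u div 2 ^ l mod 2 < 2" "v div 2 ^ l mod 2 < 2" by simp_all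
      moreover have "a = a' \<and> c = c'" if "2 * a + c = 2 * a' + c'" "c < 2" "c' < 2" for a a' c c' :: nat
        using that by presburger
      ultimately have "hash l w (?f u) = hash l w (?f v)" "u div 2 ^ l mod 2 = v div 2 ^ l mod 2"
        using uv(3) unfolding hS by blast+
      moreover have "u div 2 ^ l < 2" "v div 2 ^ l < 2"
        using uv(1,2) Suc.prems(1) by (auto simp: less_mult_imp_div_less mult.commute)
      ultimately have "?f u = ?f v" "u div 2 ^ l = v div 2 ^ l"
        using w(2) uv(1,2) by (auto dest: inj_onD)
      then show "u = v" by (metis div_mult_mod_eq)
    qed
    moreover have "hash (Suc l) ?w u < 2 ^ (card V - 1)" for u
    proof -
      have "u div 2 ^ l mod 2 < 2" by simp
      then have "hash (Suc l) ?w u < 2 * 2 ^ (card (?f ` V) - 1)" using w(3)[of "?f u"] hS[of u] by linarith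
      also have "\<dots> = 2 ^ Suc (card (?f ` V) - 1)" by simp
      also have "\<dots> \<le> 2 ^ (card V - 1)" using c by (intro power_increasing) auto
      finally show ?thesis .
    qed
    moreover have "?w < 2 ^ Suc l" using w(1) by simp
    ultimately show ?thesis by blast
  qed
qed

lemma ex_hash:
  assumes "V \<subseteq> {..<2 ^ l}"
  shows "\<exists>w<2 ^ l. inj_on (hash l w) V \<and> (\<forall>u. hash l w u < 2 ^ card V)"
proof (cases "V = {}")
  case True
  have "hash l 0 u = 0" for u using hash_le[of l 0 u] by simp
  with True show ?thesis by (intro exI[of _ 0]) auto
next
  case False
  from ex_hash_nonempty[OF assms this] obtain w where
    "w < 2 ^ l" "inj_on (hash l w) V" "\<And>u. hash l w u < 2 ^ (card V - 1)" by blast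
  moreover have "(2::nat) ^ (card V - 1) \<le> 2 ^ card V" by (intro power_increasing) auto
  ultimately show ?thesis by (meson less_le_trans)
qed

text \<open>Bounds the number of masks: \<open>l\<close> bits suffice to represent all variables,
  yet only linearly many masks lie below \<open>2 ^ l\<close>. The \<open>+ 1\<close> covers
  \<open>n = 0\<close>.\<close>

lemma ex_power_of_two: "\<exists>l. n \<le> 2 ^ l \<and> 2 ^ l \<le> 2 * n + (1::nat)"
proof (induction n)
  case 0
  show ?case by (rule exI[of _ 0]) simp
next
  case (Suc n)
  then obtain l where l: "n \<le> 2 ^ l" "2 ^ l \<le> 2 * n + (1::nat)" by blast
  show ?case
  proof (cases "Suc n \<le> 2 ^ l")
    case True
    then show ?thesis using l by (intro exI[of _ l]) auto
  next
    case False
    with l(1) have n: "n = 2 ^ l" by simp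
    then have "0 < n" by simp
    with n show ?thesis by (intro exI[of _ "Suc l"]) auto
  qed
qed

text \<open>An entry is \<open>G div b ^ p\<close> reduced modulo \<open>\<mu> p\<close>, so higher
  digits influence it. They are fixed first; the lowest digit then corrects the residue, as
  \<open>\<mu> 0 \<le> b\<close> leaves every residue available.\<close>

lemma ex_seed:
  fixes b :: nat
  assumes "\<And>p. p < m \<Longrightarrow> \<phi> p < \<mu> p \<and> \<mu> p \<le> b"
  shows "\<exists>G<b ^ m. \<forall>p<m. G div b ^ p mod \<mu> p = \<phi> p"
  using assms
proof (induction m arbitrary: \<phi> \<mu>)
  case (Suc m)
  have "\<exists>G<b ^ m. \<forall>p<m. G div b ^ p mod \<mu> (Suc p) = \<phi> (Suc p)"
    by (rule Suc.IH) (use Suc.prems in auto)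
  then obtain G where G: "G < b ^ m" "\<And>p. p < m \<Longrightarrow> G div b ^ p mod \<mu> (Suc p) = \<phi> (Suc p)" by blast
  have \<mu>: "\<phi> 0 < \<mu> 0" "\<mu> 0 \<le> b" using Suc.prems[of 0] by auto
  \<comment> \<open>The digit compensates for the residue of \<open>b * G\<close>; the subtraction
    from \<open>\<mu> 0\<close> is never truncated.\<close>
  define x where "x = (\<phi> 0 + (\<mu> 0 - b * G mod \<mu> 0)) mod \<mu> 0"
  have "x < \<mu> 0" using \<mu> unfolding x_def by (intro mod_less_divisor) simp
  with \<mu>(2) have x: "x < b" by simp
  have "(b * G + x) mod \<mu> 0 = (b * G mod \<mu> 0 + (\<phi> 0 + (\<mu> 0 - b * G mod \<mu> 0))) mod \<mu> 0"
    unfolding x_def by (simp add: mod_simps)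
  also have "b * G mod \<mu> 0 + (\<phi> 0 + (\<mu> 0 - b * G mod \<mu> 0)) = \<phi> 0 + \<mu> 0"
    using \<mu>(1) mod_less_divisor[of "\<mu> 0" "b * G"] by linarith
  finally have 0: "(b * G + x) mod \<mu> 0 = \<phi> 0" using \<mu>(1) by simp
  have "(b * G + x) div b ^ p mod \<mu> p = \<phi> p" if "p < Suc m" for p
  proof (cases p)
    case (Suc p')
    have "(b * G + x) div b ^ Suc p' = G div b ^ p'"
      using x by (simp add: div_mult2_eq)
    then show ?thesis using G(2)[of p'] that Suc by simp
  qed (use 0 in simp)
  moreover have "b * G + x < b ^ Suc m"
  proof -
    have "b * G + x < b * Suc G" using x by simp
    also have "\<dots> \<le> b * b ^ m" using G(1) by (intro mult_le_mono2) simp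
    finally show ?thesis by simp
  qed
  ultimately show ?case by blast
qed simp


section \<open>The algorithm as a bounded iteration expression\<close>

text \<open>With \<open>k\<close> arguments, \<open>Var k\<close> is the counter of an outermost
  loop and the next variable its accumulator. The first factor is the loop count, so only that one
  has to be small.\<close>

definition "MUL = Iter (Var 0) (Const 0) (Plus (Var 3) (Var 1))"

definition "DIV = Iter (Var 0) (Const 0)
  (IfZero (Minus (App MUL [Plus (Var 3) (Const 1), Var 1]) (Var 0))
    (Plus (Var 3) (Const 1)) (Var 3))"

definition "MOD = Minus (Var 0) (App MUL [App DIV [Var 0, Var 1], Var 1])"

definition "NEQ = Plus (Minus (Var 0) (Var 1)) (Minus (Var 1) (Var 0))"

definition "MAXIMUM = IfZero (Minus (Var 0) (Var 1)) (Var 1) (Var 0)"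

definition "POW2 = Iter (Var 0) (Const 1) (Plus (Var 2) (Var 2))"

definition "NVARS = Inp (Const 0)"

text \<open>A prefix entry occupies one cell for the quantifier, one for the length and then the
  domain. At the number of variables, the result is the address of the number of
  constraints.\<close>

definition "PTR = Iter (Var 0) (Const 1)
  (Plus (Plus (Var 2) (Const 2)) (Inp (Plus (Var 2) (Const 1))))"

definition "QUANT = Inp (App PTR [Var 0])"

definition "DSIZE = Inp (Plus (App PTR [Var 0]) (Const 1))"

definition "NCONS = Inp (App PTR [NVARS])"

text \<open>All tuples of a relation have the length of the scope, so a constraint is skipped by one
  multiplication.\<close>

definition "CPTR = Iter (Var 0) (Plus (App PTR [NVARS]) (Const 1))
  (Plus (Plus (Plus (Var 2) (Inp (Var 2))) (Const 2))
    (App MUL [Inp (Plus (Plus (Var 2) (Inp (Var 2))) (Const 1)), Plus (Inp (Var 2)) (Const 1)]))"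

definition "NUM_EX = Iter NVARS (Const 0) (Plus (Var 1) (App QUANT [Var 0]))"

definition "MAX_DOM = Iter NVARS (Const 0) (App MAXIMUM [Var 1, App DSIZE [Var 0]])"

definition "MAX_AR = Iter NCONS (Const 0) (App MAXIMUM [Var 1, Inp (App CPTR [Var 0])])"

text \<open>The machine is not given the parameter and computes it from the instance.\<close>

definition "PARAM = Plus (Plus (App NUM_EX []) (App MAX_DOM [])) (App MAX_AR [])"

definition "LEAVES = App POW2 [App MUL [Var 0, Var 0]]"

definition "SEEDS = App POW2 [App MUL [Var 0,
  App MUL [LEAVES, App POW2 [App MUL [Var 0, LEAVES]]]]]"

definition "PROD_EX = Iter (Var 0) (Const 1)
  (IfZero (App QUANT [Var 1]) (Var 2) (App MUL [App DSIZE [Var 1], Var 2]))"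

definition "HASH = Iter (Plus NVARS NVARS) (Const 0)
  (IfZero (App MOD [App DIV [Var 0, App POW2 [Var 2]], Const 2]) (Var 3)
    (Plus (Plus (Var 3) (Var 3)) (App MOD [App DIV [Var 1, App POW2 [Var 2]], Const 2])))"

text \<open>Shifts the table by \<open>p\<close> entries of \<open>K\<close> bits each; the
  reduction to the domain size follows in \<open>INDEX\<close>.\<close>

definition "DIGIT = Iter (Var 1) (Var 0) (App DIV [Var 3, App POW2 [PARAM]])"

text \<open>The arguments are variable, mask, seed and existential code. The table has a row for
  each hash value and a column for each code of the preceding existential moves.\<close>

definition "INDEX = IfZero (App QUANT [Var 0])
  (App MOD
    [App DIGIT [Var 2,
      Plus (App MUL [App HASH [Var 1, Var 0], App LEAVES [PARAM]])
        (App MOD [Var 3, App PROD_EX [Var 0]])],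
     App DSIZE [Var 0]])
  (App MOD [App DIV [Var 3, App PROD_EX [Var 0]], App DSIZE [Var 0]])"

definition "VALUE = Inp (Plus (Plus (App PTR [Var 0]) (Const 2))
  (App INDEX [Var 0, Var 1, Var 2, Var 3]))"

text \<open>The first two arguments are the addresses of a tuple and of its constraint; the offset 1
  skips the length cell in front of each list.\<close>

definition "MISMATCH = Iter (Inp (Var 1)) (Const 0)
  (IfZero (App NEQ [Inp (Plus (Plus (Var 0) (Const 1)) (Var 5)),
      App VALUE [Inp (Plus (Plus (Var 1) (Const 1)) (Var 5)), Var 2, Var 3, Var 4]])
    (Var 6) (Const 1))"

definition "SAT = Iter (Inp (Plus (Plus (Var 0) (Inp (Var 0))) (Const 1))) (Const 0)
  (IfZero (App MISMATCH
      [Plus (Plus (Plus (Var 0) (Inp (Var 0))) (Const 2)) (App MUL [Var 4, Plus (Inp (Var 0)) (Const 1)]),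
       Var 0, Var 1, Var 2, Var 3])
    (Const 1) (Var 5))"

definition "ALL_SAT = Iter NCONS (Const 1)
  (IfZero (App SAT [App CPTR [Var 3], Var 0, Var 1, Var 2]) (Const 0) (Var 4))"

definition "WINS = Iter (App PROD_EX [NVARS]) (Const 1)
  (IfZero (App ALL_SAT [Var 0, Var 1, Var 2]) (Var 3) (Const 0))"

definition "SOME_SEED = Iter (App SEEDS [PARAM]) (Const 0)
  (IfZero (App WINS [Var 0, Var 1]) (Var 2) (Const 1))"

definition "UNIV_WINS = Iter (Plus (Plus NVARS NVARS) (Const 1)) (Const 0)
  (IfZero (App SOME_SEED [Var 0]) (Var 1) (Const 1))"

text \<open>The value 2 stands for the absence of empty domains, any other value is the answer.\<close>

definition "FIRST_EMPTY = Iter NVARS (Const 2)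
  (IfZero (Minus (Var 1) (Const 1)) (Var 1)
    (IfZero (App DSIZE [Var 0]) (Minus (Const 1) (App QUANT [Var 0])) (Var 1)))"

definition "DECIDE = IfZero (Minus FIRST_EMPTY (Const 1)) FIRST_EMPTY (Minus (Const 1) UNIV_WINS)"


definition leaves :: "nat \<Rightarrow> nat" where
  "leaves K = 2 ^ (K * K)"

text \<open>The number of tables with \<open>K\<close> bits per entry, \<open>leaves K\<close>
  columns and one row for each of the \<open>2 ^ (K * leaves K)\<close> hash values that a
  separating mask may use.\<close>

definition seeds :: "nat \<Rightarrow> nat" where
  "seeds K = 2 ^ (K * (leaves K * 2 ^ (K * leaves K)))"

text \<open>The bound \<open>N\<close> is fixed so that the conditional rewrite rules below need not guess it.\<close>

locale machine =
  fixes inp :: "nat list" and N :: nat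
begin

text \<open>\<open>R j\<close> is the accumulator after \<open>j\<close> rounds. Value and bound are
  proved together, since the bound on the body is required only at these accumulators.\<close>

lemma Iter_correct:
  assumes "eval inp env n = m" "bnd inp N env n" "m \<le> N" "R m = v"
    "eval inp env i = R 0" "bnd inp N env i"
    "\<And>j. j < m \<Longrightarrow> eval inp (env @ [j, R j]) s = R (Suc j) \<and> bnd inp N (env @ [j, R j]) s"
  shows "eval inp env (Iter n i s) = v \<and> bnd inp N env (Iter n i s)"
proof -
  have "rec_nat (eval inp env i) (\<lambda>j a. eval inp (env @ [j, a]) s) j = R j" if "j \<le> m" for j
    using that by (induction j) (use assms in auto)
  then show ?thesis using assms by auto
qed

text \<open>A search without early exit: after a hit the accumulator is \<open>d\<close>, and later
  rounds either keep it or write \<open>d\<close> again.\<close>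

lemma Iter_search:
  assumes "eval inp env n = m" "bnd inp N env n" "m \<le> N" "eval inp env i = c" "bnd inp N env i"
    "\<And>j a. j < m \<Longrightarrow> eval inp (env @ [j, a]) s = (if P j then d else a) \<and> bnd inp N (env @ [j, a]) s"
  shows "eval inp env (Iter n i s) = (if \<exists>j<m. P j then d else c) \<and> bnd inp N env (Iter n i s)"
  by (rule Iter_correct[where R = "\<lambda>j. if \<exists>i<j. P i then d else c" and m = m])
    (use assms in \<open>auto simp: less_Suc_eq\<close>)

lemma MUL_correct [simp]:
  "x \<le> N \<Longrightarrow> eval inp [x, y] MUL = x * y \<and> bnd inp N [x, y] MUL"
  unfolding MUL_def by (rule Iter_correct[where R = "\<lambda>j. j * y"]) auto

lemma DIV_correct [simp]:
  assumes "x \<le> N" "0 < y"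
  shows "eval inp [x, y] DIV = x div y \<and> bnd inp N [x, y] DIV"
  unfolding DIV_def
proof (rule Iter_correct[where R = "\<lambda>j. min j (x div y)"])
  fix j assume j: "j < x"
  let ?a = "min j (x div y)"
  have "(?a + 1) * y \<le> x \<longleftrightarrow> j < x div y"
    using assms(2) j by (auto simp: min_def less_eq_div_iff_mult_less_eq[symmetric] simp del: mult_Suc)
  moreover have "Suc ?a \<le> N" using j assms(1) by simp
  ultimately show "eval inp ([x, y] @ [j, ?a])
     (IfZero (Minus (App MUL [Plus (Var 3) (Const 1), Var 1]) (Var 0)) (Plus (Var 3) (Const 1)) (Var 3)) =
    min (Suc j) (x div y) \<and>
    bnd inp N ([x, y] @ [j, ?a])
     (IfZero (Minus (App MUL [Plus (Var 3) (Const 1), Var 1]) (Var 0)) (Plus (Var 3) (Const 1)) (Var 3))"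
    by (auto simp del: mult_Suc)
qed (use assms in auto)

lemma MOD_correct [simp]:
  assumes "x \<le> N" "0 < y"
  shows "eval inp [x, y] MOD = x mod y \<and> bnd inp N [x, y] MOD"
proof -
  have "x div y \<le> N" using assms by (meson div_le_dividend order_trans)
  then show ?thesis using assms by (simp add: MOD_def minus_div_mult_eq_mod)
qed

lemma NEQ_correct [simp]:
  "(eval inp [x, y] NEQ = 0) = (x = y) \<and> bnd inp N [x, y] NEQ"
  by (auto simp: NEQ_def)

lemma MAXIMUM_correct [simp]:
  "eval inp [x, y] MAXIMUM = max x y \<and> bnd inp N [x, y] MAXIMUM"
  by (auto simp: MAXIMUM_def)

lemma POW2_correct [simp]:
  "x \<le> N \<Longrightarrow> eval inp [x] POW2 = 2 ^ x \<and> bnd inp N [x] POW2"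
  unfolding POW2_def by (rule Iter_correct[where R = "\<lambda>j. 2 ^ j"]) auto

text \<open>These quantities occur as iteration counts, so that \<open>seeds K \<le> N\<close>
  covers all counts that depend on \<open>K\<close> only.\<close>

lemma seeds_bounds: "K \<le> seeds K" "K * K \<le> seeds K" "leaves K \<le> seeds K" "K * leaves K \<le> seeds K"
  "2 ^ (K * leaves K) \<le> seeds K" "K * (leaves K * 2 ^ (K * leaves K)) \<le> seeds K"
proof -
  have "0 < leaves K" by (simp add: leaves_def)
  show 6: "K * (leaves K * 2 ^ (K * leaves K)) \<le> seeds K"
    by (simp add: seeds_def less_imp_le)
  have lt: "x \<le> 2 ^ x" for x :: nat by (simp add: less_imp_le)
  show "2 ^ (K * leaves K) \<le> seeds K"
  proof -
    have "K * leaves K * 1 \<le> K * leaves K * 2 ^ (K * leaves K)" by (rule mult_le_mono2) simp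
    then show ?thesis unfolding seeds_def by (simp add: mult.assoc)
  qed
  with lt[of "K * leaves K"] show KL: "K * leaves K \<le> seeds K" by linarith
  have "K * 1 \<le> K * leaves K" using \<open>0 < leaves K\<close> by (intro mult_le_mono2) simp
  with KL show "K \<le> seeds K" by linarith
  show "leaves K \<le> seeds K"
  \<comment> \<open>For \<open>K = 0\<close>, \<open>K * leaves K\<close> does not dominate
    \<open>leaves K\<close>, but then both sides are 1.\<close>
  proof (cases K)
    case (Suc k)
    then have "1 * leaves K \<le> K * leaves K" by (intro mult_le_mono1) simp
    with KL show ?thesis by linarith
  qed (simp add: leaves_def seeds_def)
  with lt[of "K * K"] show "K * K \<le> seeds K" unfolding leaves_def by linarith
qed

lemma LEAVES_correct [simp]:
  assumes "seeds K \<le> N"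
  shows "eval inp [K] LEAVES = leaves K \<and> bnd inp N [K] LEAVES"
  using assms seeds_bounds[of K] by (simp add: LEAVES_def leaves_def)

lemma SEEDS_correct [simp]:
  assumes "seeds K \<le> N"
  shows "eval inp [K] SEEDS = seeds K \<and> bnd inp N [K] SEEDS"
proof -
  have "K \<le> N" "leaves K \<le> N" "K * leaves K \<le> N" "K * (leaves K * 2 ^ (K * leaves K)) \<le> N"
    using assms seeds_bounds[of K] by linarith+
  then show ?thesis unfolding SEEDS_def seeds_def using assms by simp
qed

end

section \<open>Addresses and contents of the encoded instance\<close>

lemma drop_concat_map:
  assumes "i < length xs"
  shows "drop (length (concat (map e (take i xs)))) (concat (map e xs) @ ys) =
    e (xs ! i) @ concat (map e (drop (Suc i) xs)) @ ys"
proof -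
  have "concat (map e xs) = concat (map e (take i xs)) @ e (xs ! i) @ concat (map e (drop (Suc i) xs))"
    by (subst id_take_nth_drop[OF assms]) simp
  then show ?thesis by simp
qed

lemma rd_drop: "drop p inp = ys \<Longrightarrow> k < length ys \<Longrightarrow> rd inp (p + k) = ys ! k"
  by (auto simp: rd_def)

lemma Max_insert_lessThan_Suc:
  "Max (insert (0::nat) (g ` {..<Suc n})) = max (Max (insert 0 (g ` {..<n}))) (g n)"
proof -
  have "insert 0 (g ` {..<Suc n}) = insert (g n) (insert 0 (g ` {..<n}))"
    by (auto simp: lessThan_Suc)
  then show ?thesis
    by (simp del: Max_insert2 add: Max.insert[of "insert 0 (g ` {..<n})"] max.commute)
qed

text \<open>Each iteration count is linear in the input length, bounded in terms of the parameter,
  or a product of two such numbers; \<open>N\<close> dominates them all.\<close>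

locale qcsp_machine =
  fixes I :: qcsp and N :: nat
  assumes wf: "wf_qcsp I"
    and N: "4 * length (enc_qcsp I) * seeds (num_existential I + domain_size I + max_arity I) \<le> N"
begin

abbreviation "inp \<equiv> enc_qcsp I"

sublocale machine inp N .

abbreviation "n \<equiv> length (qprefix I)"
abbreviation "D i \<equiv> snd (qprefix I ! i)"
abbreviation "ex i \<equiv> fst (qprefix I ! i) = Exists"
abbreviation "K \<equiv> num_existential I + domain_size I + max_arity I"

definition "ptr i = Suc (length (concat (map enc_quantified (take i (qprefix I)))))"

definition "cptr j = Suc (ptr n + length (concat (map enc_constraint (take j (constraints I)))))"

lemma inp_eq: "inp = n # concat (map enc_quantified (qprefix I)) @
    length (constraints I) # concat (map enc_constraint (constraints I))"
  by (simp add: enc_qcsp_def enc_list_def)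

lemma drop_ptr:
  assumes "i < n"
  obtains r where "drop (ptr i) inp = (if ex i then 1 else 0) # length (D i) # D i @ r"
proof -
  have "drop (ptr i) inp = drop (length (concat (map enc_quantified (take i (qprefix I)))))
      (concat (map enc_quantified (qprefix I)) @
        length (constraints I) # concat (map enc_constraint (constraints I)))"
    by (simp add: inp_eq ptr_def)
  also note drop_concat_map[OF assms]
  finally show thesis using that
    by (cases "qprefix I ! i") (auto simp: enc_nats_def enc_list_def split: quantifier.splits)
qed

lemma ptr_0: "ptr 0 = 1"
  by (simp add: ptr_def)

lemma ptr_Suc: "i < n \<Longrightarrow> ptr (Suc i) = ptr i + 2 + length (D i)"
  by (cases "qprefix I ! i")
    (simp add: ptr_def take_Suc_conv_app_nth enc_nats_def enc_list_def comp_def)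

lemma rd_quant: "i < n \<Longrightarrow> rd inp (ptr i) = (if ex i then 1 else 0)"
  by (erule drop_ptr, drule rd_drop[where k = 0]) (auto split: if_splits)

lemma rd_dsize: "i < n \<Longrightarrow> rd inp (Suc (ptr i)) = length (D i)"
  by (erule drop_ptr, drule rd_drop[where k = 1]) (auto split: if_splits)

lemma rd_dom:
  assumes "i < n" "k < length (D i)"
  shows "rd inp (Suc (Suc (ptr i + k))) = D i ! k"
proof -
  obtain r where "drop (ptr i) inp = (if ex i then 1 else 0) # length (D i) # D i @ r"
    by (rule drop_ptr[OF assms(1)])
  from rd_drop[OF this, of "Suc (Suc k)"] show ?thesis using assms(2) by (simp add: nth_append)
qed

lemma drop_ptr_n: "drop (ptr n) inp = length (constraints I) # concat (map enc_constraint (constraints I))"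
  by (simp add: inp_eq ptr_def)

lemma rd_0: "rd inp 0 = n"
  by (simp add: inp_eq rd_def)

lemma rd_ncons: "rd inp (ptr n) = length (constraints I)"
  using rd_drop[OF drop_ptr_n, of 0] by simp

lemma tuple_length:
  assumes "(s, R) \<in> set (constraints I)" "t \<in> set R"
  shows "length t = length s"
  using wf assms unfolding wf_qcsp_def by (auto dest!: bspec list_all2_lengthD)

lemma length_enc_tuples:
  "(\<And>t. t \<in> set R \<Longrightarrow> length t = m) \<Longrightarrow> length (concat (map enc_nats R)) = length R * Suc m"
  by (induction R) (auto simp: enc_nats_def enc_list_def comp_def)

lemma drop_cptr:
  assumes "j < length (constraints I)" "constraints I ! j = (s, R)"
  obtains r where "drop (cptr j) inp =
    length s # s @ length R # concat (map enc_nats R) @ r"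
proof -
  have "drop (cptr j) inp = drop (length (concat (map enc_constraint (take j (constraints I)))))
      (concat (map enc_constraint (constraints I)) @ [])"
  proof -
    have "drop (cptr j) inp =
        drop (Suc (length (concat (map enc_constraint (take j (constraints I)))))) (drop (ptr n) inp)"
      unfolding drop_drop by (simp add: cptr_def add.commute)
    then show ?thesis by (simp add: drop_ptr_n)
  qed
  also note drop_concat_map[OF assms(1)]
  finally show thesis using that assms(2)
    by (auto simp: enc_nats_def enc_list_def)
qed

lemma cptr_0: "cptr 0 = Suc (ptr n)"
  by (simp add: cptr_def)

lemma cptr_Suc:
  assumes "j < length (constraints I)" "constraints I ! j = (s, R)"
  shows "cptr (Suc j) = cptr j + length s + 2 + length R * Suc (length s)"
proof -
  have "(s, R) \<in> set (constraints I)" using assms by (metis nth_mem)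
  then have "length (concat (map enc_nats R)) = length R * Suc (length s)"
    by (intro length_enc_tuples) (rule tuple_length)
  then show ?thesis using assms
    by (simp add: cptr_def take_Suc_conv_app_nth enc_list_def enc_nats_def comp_def)
qed

lemma rd_constraint:
  assumes "j < length (constraints I)" "constraints I ! j = (s, R)"
  shows "rd inp (cptr j) = length s"
    and "l < length s \<Longrightarrow> rd inp (Suc (cptr j + l)) = s ! l"
    and "rd inp (Suc (cptr j + length s)) = length R"
    and "t < length R \<Longrightarrow> l < length s \<Longrightarrow>
      rd inp (Suc (Suc (Suc (cptr j + length s + t * Suc (length s) + l)))) = R ! t ! l"
proof -
  obtain r where r: "drop (cptr j) inp = length s # s @ length R # concat (map enc_nats R) @ r"
    by (rule drop_cptr[OF assms])
  have sR: "(s, R) \<in> set (constraints I)" using assms by (metis nth_mem)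
  show "rd inp (cptr j) = length s" using rd_drop[OF r, of 0] by simp
  show "rd inp (Suc (cptr j + l)) = s ! l" if "l < length s"
    using rd_drop[OF r, of "Suc l"] that by (simp add: nth_append)
  show "rd inp (Suc (cptr j + length s)) = length R"
    using rd_drop[OF r, of "Suc (length s)"] by simp
  assume t: "t < length R" and l: "l < length s"
  have "length (concat (map enc_nats (take t R))) = length (take t R) * Suc (length s)"
    by (rule length_enc_tuples) (use tuple_length[OF sR] in \<open>auto dest: in_set_takeD\<close>)
  then have len: "length (concat (map enc_nats (take t R))) = t * Suc (length s)" using t by simp
  have "drop (t * Suc (length s)) (drop (Suc (Suc (length s))) (drop (cptr j) inp)) =
      enc_nats (R ! t) @ concat (map enc_nats (drop (Suc t) R)) @ r"
    using drop_concat_map[OF t, of enc_nats r] unfolding len r by simp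
  then have "drop (cptr j + (Suc (Suc (length s)) + t * Suc (length s))) inp =
      enc_nats (R ! t) @ concat (map enc_nats (drop (Suc t) R)) @ r"
    by (simp add: add.commute add.left_commute)
  from rd_drop[OF this, of "Suc l"] tuple_length[OF sR, of "R ! t"] t l
  show "rd inp (Suc (Suc (Suc (cptr j + length s + t * Suc (length s) + l)))) = R ! t ! l"
    by (simp add: enc_nats_def enc_list_def comp_def nth_append ac_simps)
qed

text \<open>A prefix entry takes at least two cells and a constraint at least one; the two list
  lengths account for the rest.\<close>

lemma length_inp: "2 * n + length (constraints I) + 2 \<le> length inp"
proof -
  have "2 * length Q \<le> length (concat (map enc_quantified Q))" for Q
    by (induction Q) (auto simp: enc_nats_def enc_list_def)
  moreover have "length Cs \<le> length (concat (map enc_constraint Cs))" for Cs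
    by (induction Cs) (auto simp: enc_nats_def enc_list_def)
  ultimately have "2 * n + length (constraints I) \<le>
      length (concat (map enc_quantified (qprefix I))) + length (concat (map enc_constraint (constraints I)))"
    by (intro add_mono) auto
  then show ?thesis by (simp add: inp_eq)
qed

lemma mult_bound: "x \<le> 4 * length inp \<Longrightarrow> y \<le> seeds K \<Longrightarrow> x * y \<le> N"
  using N mult_le_mono order_trans by blast

lemma seeds_le [simp]: "seeds K \<le> N"
  using mult_bound[of 1 "seeds K"] length_inp by simp

lemma length_inp_le: "4 * length inp \<le> N"
  using mult_bound[of "4 * length inp" 1] by (simp add: seeds_def)

lemma n_bounds [simp]: "n \<le> N" "length (constraints I) \<le> N" "n + n \<le> N" "Suc (n + n) \<le> N"
  using length_inp length_inp_le by linarith+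

lemma length_D_le [simp]:
  assumes "i < n"
  shows "length (D i) \<le> N"
proof -
  obtain r where "drop (ptr i) inp = (if ex i then 1 else 0) # length (D i) # D i @ r"
    by (rule drop_ptr[OF assms])
  then have "length (drop (ptr i) inp) = 2 + length (D i) + length r" by simp
  then show ?thesis using length_inp_le by simp
qed

lemma constraint_le:
  assumes "j < length (constraints I)" "constraints I ! j = (s, R)"
  shows "length s \<le> N" "length R \<le> N"
proof -
  obtain r where "drop (cptr j) inp = length s # s @ length R # concat (map enc_nats R) @ r"
    by (rule drop_cptr[OF assms])
  then have "length (drop (cptr j) inp) =
      2 + length s + length (concat (map enc_nats R)) + length r" by simp
  moreover have "length R \<le> length (concat (map enc_nats R))"
    by (induction R) (auto simp: enc_nats_def enc_list_def)
  ultimately show "length s \<le> N" "length R \<le> N" using length_inp_le by auto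
qed

section \<open>Correctness of the expressions that read the instance\<close>

lemma NVARS_correct [simp]: "eval inp env NVARS = n \<and> bnd inp N env NVARS"
  by (simp add: NVARS_def rd_0)

lemma PTR_correct [simp]:
  assumes "i \<le> n"
  shows "eval inp [i] PTR = ptr i \<and> bnd inp N [i] PTR"
  unfolding PTR_def
  by (rule Iter_correct[where R = ptr])
    (use assms order_trans[OF assms n_bounds(1)] in \<open>auto simp: ptr_0 ptr_Suc rd_dsize\<close>)

lemma QUANT_correct [simp]:
  "i < n \<Longrightarrow> eval inp [i] QUANT = (if ex i then 1 else 0) \<and> bnd inp N [i] QUANT"
  by (simp add: QUANT_def rd_quant)

lemma DSIZE_correct [simp]:
  "i < n \<Longrightarrow> eval inp [i] DSIZE = length (D i) \<and> bnd inp N [i] DSIZE"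
  by (simp add: DSIZE_def rd_dsize)

lemma NCONS_correct [simp]:
  "eval inp env NCONS = length (constraints I) \<and> bnd inp N env NCONS"
  by (simp add: NCONS_def rd_ncons)

lemma CPTR_correct [simp]:
  assumes "i \<le> length (constraints I)"
  shows "eval inp [i] CPTR = cptr i \<and> bnd inp N [i] CPTR"
  unfolding CPTR_def
proof (rule Iter_correct[where R = cptr])
  fix j assume "j < i"
  with assms have j: "j < length (constraints I)" by simp
  obtain s R where sR: "constraints I ! j = (s, R)" by (cases "constraints I ! j")
  let ?s = "Plus (Plus (Plus (Var 2) (Inp (Var 2))) (Const 2))
    (App MUL [Inp (Plus (Plus (Var 2) (Inp (Var 2))) (Const 1)), Plus (Inp (Var 2)) (Const 1)])"
  show "eval inp ([i] @ [j, cptr j]) ?s = cptr (Suc j) \<and> bnd inp N ([i] @ [j, cptr j]) ?s"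
    using constraint_le[OF j sR] rd_constraint(1,3)[OF j sR] cptr_Suc[OF j sR] by simp
qed (use assms order_trans[OF assms n_bounds(2)] in \<open>auto simp: cptr_0\<close>)

lemma NUM_EX_correct [simp]: "eval inp [] NUM_EX = num_existential I \<and> bnd inp N [] NUM_EX"
proof -
  have "(\<Sum>i<n. if ex i then 1 else 0) = num_existential I"
    by (simp add: num_existential_def sum.If_cases Int_def conj_commute)
  then show ?thesis unfolding NUM_EX_def
    by (intro Iter_correct[where R = "\<lambda>j. \<Sum>i<j. if ex i then 1 else 0" and m = n]) auto
qed

lemma length_D: "i < n \<Longrightarrow> card (qdomain I i) = length (D i)"
  using wf by (cases "qprefix I ! i") (fastforce simp: wf_qcsp_def qdomain_def distinct_card dest: nth_mem)

lemma MAX_DOM_correct [simp]: "eval inp [] MAX_DOM = domain_size I \<and> bnd inp N [] MAX_DOM"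
proof -
  have "domain_size I = Max (insert 0 ((\<lambda>i. length (D i)) ` {..<n}))"
    by (simp add: domain_size_def length_D)
  then show ?thesis unfolding MAX_DOM_def
    by (intro Iter_correct[where R = "\<lambda>j. Max (insert 0 ((\<lambda>i. length (D i)) ` {..<j}))" and m = n])
      (auto simp: Max_insert_lessThan_Suc simp del: Max_insert2)
qed

lemma MAX_AR_correct [simp]: "eval inp [] MAX_AR = max_arity I \<and> bnd inp N [] MAX_AR"
proof -
  have "set (constraints I) = (!) (constraints I) ` {..<length (constraints I)}"
    by (auto simp: set_conv_nth)
  then have "max_arity I = Max (insert 0 ((\<lambda>j. length (fst (constraints I ! j))) ` {..<length (constraints I)}))"
    by (simp add: max_arity_def image_image)
  moreover have "rd inp (cptr j) = length (fst (constraints I ! j))" if "j < length (constraints I)" for j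
    using rd_constraint(1)[OF that prod.collapse[symmetric]] .
  ultimately show ?thesis unfolding MAX_AR_def
    by (intro Iter_correct[where m = "length (constraints I)" and
          R = "\<lambda>j. Max (insert 0 ((\<lambda>j. length (fst (constraints I ! j))) ` {..<j}))"])
      (auto simp: Max_insert_lessThan_Suc simp del: Max_insert2)
qed

lemma PARAM_correct [simp]: "eval inp env PARAM = K \<and> bnd inp N env PARAM"
  by (simp add: PARAM_def)

definition "pr i = (\<Prod>j<i. if ex j then length (D j) else 1)"

lemma pr_Suc: "pr (Suc i) = (if ex i then length (D i) else 1) * pr i"
  by (simp add: pr_def mult.commute)

lemma PROD_EX_correct [simp]:
  assumes "i \<le> n"
  shows "eval inp [i] PROD_EX = pr i \<and> bnd inp N [i] PROD_EX"
  unfolding PROD_EX_def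
  by (rule Iter_correct[where R = pr])
    (use assms order_trans[OF assms n_bounds(1)] in \<open>auto simp: pr_Suc pr_def\<close>)

lemma FIRST_EMPTY_correct [simp]:
  "eval inp [] FIRST_EMPTY =
      (if \<exists>i<n. D i = [] then if ex (LEAST i. D i = []) then 0 else 1 else 2) \<and>
    bnd inp N [] FIRST_EMPTY"
  unfolding FIRST_EMPTY_def
proof (rule Iter_correct[where m = n and R = "\<lambda>j.
    if \<exists>i<j. D i = [] then if ex (LEAST i. D i = []) then 0 else 1 else 2"])
  fix j assume j: "j < n"
  let ?R = "\<lambda>j. if \<exists>i<j. D i = [] then if ex (LEAST i. D i = []) then 0 else 1 else 2 :: nat"
  let ?s = "IfZero (Minus (Var 1) (Const 1)) (Var 1)
    (IfZero (App DSIZE [Var 0]) (Minus (Const 1) (App QUANT [Var 0])) (Var 1))"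
  show "eval inp ([] @ [j, ?R j]) ?s = ?R (Suc j) \<and> bnd inp N ([] @ [j, ?R j]) ?s"
  proof (cases "\<exists>i<j. D i = []")
    case False
    then have "(LEAST i. D i = []) = j" if "D j = []"
      using that by (intro Least_equality) (auto simp: not_less[symmetric])
    with False j show ?thesis by (auto simp: less_Suc_eq)
  qed (auto simp: less_Suc_eq)
qed auto

lemma HASH_correct [simp]:
  assumes "w \<le> N" "i \<le> N"
  shows "eval inp [w, i] HASH = hash (2 * n) w i \<and> bnd inp N [w, i] HASH"
  unfolding HASH_def
proof (rule Iter_correct[where R = "\<lambda>j. hash j w i" and m = "n + n"])
  fix j assume "j < n + n"
  then have "j \<le> N" using n_bounds(3) by linarith
  moreover have "w div 2 ^ j \<le> N" "i div 2 ^ j \<le> N"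
    using assms by (meson div_le_dividend order_trans)+
  ultimately show "eval inp ([w, i] @ [j, hash j w i])
      (IfZero (App MOD [App DIV [Var 0, App POW2 [Var 2]], Const 2]) (Var 3)
        (Plus (Plus (Var 3) (Var 3)) (App MOD [App DIV [Var 1, App POW2 [Var 2]], Const 2]))) =
    hash (Suc j) w i \<and>
    bnd inp N ([w, i] @ [j, hash j w i])
      (IfZero (App MOD [App DIV [Var 0, App POW2 [Var 2]], Const 2]) (Var 3)
        (Plus (Plus (Var 3) (Var 3)) (App MOD [App DIV [Var 1, App POW2 [Var 2]], Const 2])))"
    using assms by (auto simp: mod2_eq_if)
qed (auto simp: mult_2)

lemma DIGIT_correct [simp]:
  assumes "G \<le> N" "p \<le> N"
  shows "eval inp [G, p] DIGIT = G div (2 ^ K) ^ p \<and> bnd inp N [G, p] DIGIT"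
  unfolding DIGIT_def
proof (rule Iter_correct[where R = "\<lambda>j. G div (2 ^ K) ^ j"])
  fix j
  have "K \<le> N" using seeds_bounds(1)[of K] seeds_le by linarith
  moreover have "G div (2 ^ K) ^ j \<le> N" using assms by (meson div_le_dividend order_trans)
  moreover have "G div (2 ^ K) ^ j div 2 ^ K = G div (2 ^ K) ^ Suc j"
    by (simp only: power_Suc2 div_mult2_eq)
  ultimately show "eval inp ([G, p] @ [j, G div (2 ^ K) ^ j]) (App DIV [Var 3, App POW2 [PARAM]]) =
      G div (2 ^ K) ^ Suc j \<and>
    bnd inp N ([G, p] @ [j, G div (2 ^ K) ^ j]) (App DIV [Var 3, App POW2 [PARAM]])"
    by simp
qed (use assms in auto)

section \<open>The strategy given by a mask and a seed\<close>

definition "index w G A i =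
  (if ex i then A div pr i
   else G div (2 ^ K) ^ (hash (2 * n) w i * leaves K + A mod pr i)) mod length (D i)"

definition "val w G A i = D i ! index w G A i"

lemma length_D_le_pow:
  assumes "i < n"
  shows "length (D i) \<le> 2 ^ K"
proof -
  have "length (D i) \<le> domain_size I"
    using assms unfolding domain_size_def by (intro Max_ge) (auto simp: length_D image_iff)
  then show ?thesis using less_exp[of K] by linarith
qed

text \<open>At most \<open>K\<close> existential variables precede, and each contributes at most
  \<open>2 ^ K\<close>.\<close>

lemma pr_le_leaves:
  assumes "i \<le> n"
  shows "pr i \<le> leaves K"
proof -
  have "pr i \<le> (\<Prod>j<i. if ex j then 2 ^ K else 1)"
    unfolding pr_def using length_D_le_pow assms by (intro prod_mono) auto
  also have "\<dots> = (\<Prod>j\<in>{j. j < i \<and> ex j}. 2 ^ K)"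
    by (simp add: prod.If_cases Int_def)
  also have "\<dots> = 2 ^ (K * card {j. j < i \<and> ex j})"
    by (simp add: power_mult)
  also have "\<dots> \<le> 2 ^ (K * K)"
  proof -
    have "card {j. j < i \<and> ex j} \<le> num_existential I"
      unfolding num_existential_def using assms by (intro card_mono) auto
    then show ?thesis by (intro power_increasing mult_le_mono2) auto
  qed
  finally show ?thesis by (simp add: leaves_def)
qed

text \<open>Any mask and seed give a legal strategy, because \<open>play\<close> reduces its choices
  modulo the domain size.\<close>

definition "choice w G i c = G div (2 ^ K) ^ (hash (2 * n) w i * leaves K + c)"

lemma num_leaves_take:
  assumes "i \<le> n"
  shows "num_leaves (take i (qprefix I)) = pr i"
  using assms
proof (induction i)
  case (Suc i)
  have "num_leaves (Q @ [x]) = num_leaves Q * (if fst x = Exists then length (snd x) else 1)" for Q x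
    by (cases x) (simp add: num_leaves_def)
  with Suc show ?case by (simp add: take_Suc_conv_app_nth pr_Suc)
qed (simp add: pr_def)

lemma play_nth_pr:
  assumes "i < n"
  shows "play \<sigma> A 0 (Suc 0) (qprefix I) ! i =
    D i ! ((if ex i then A div pr i else \<sigma> i (A mod pr i)) mod length (D i))"
  using play_nth[OF assms, of \<sigma> A 0 "Suc 0"] num_leaves_take[of i] assms by (simp add: Let_def)

lemma val_eq_play: "map (val w G A) [0..<n] = play (choice w G) A 0 (Suc 0) (qprefix I)"
  by (rule nth_equalityI) (simp_all add: play_nth_pr val_def index_def choice_def)

lemma scope_less: "C \<in> set (constraints I) \<Longrightarrow> i \<in> set (fst C) \<Longrightarrow> i < n"
  using wf by (cases C) (auto simp: wf_qcsp_def)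

end

section \<open>Evaluation of the search when no domain is empty\<close>

locale nonempty_qcsp_machine = qcsp_machine +
  assumes nonempty: "i < n \<Longrightarrow> D i \<noteq> []"
begin

lemma pr_pos: "i \<le> n \<Longrightarrow> 0 < pr i"
  unfolding pr_def using nonempty by (intro prod_pos) auto

lemma INDEX_correct [simp]:
  assumes "i < n" "w \<le> 2 * n" "G \<le> seeds K" "A \<le> leaves K"
  shows "eval inp [i, w, G, A] INDEX = index w G A i \<and> bnd inp N [i, w, G, A] INDEX"
proof -
  have le: "w \<le> N" "i \<le> N" "G \<le> N" "A \<le> N"
    using assms n_bounds seeds_le seeds_bounds(3)[of K] by linarith+
  \<comment> \<open>For an arbitrary mask only this linear bound is available. It keeps the table
    position at most \<open>(2 * n + 1) * leaves K\<close>.\<close>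
  have "hash (2 * n) w i \<le> w" using hash_le[of "2 * n" w i] by (meson mod_less_eq_dividend order_trans)
  then have h: "hash (2 * n) w i \<le> 2 * n" using assms(2) by simp
  have pr: "0 < pr i" "pr i \<le> leaves K" using assms(1) by (simp_all add: pr_pos pr_le_leaves)
  have "A mod pr i \<le> leaves K" using assms(4) by (meson mod_less_eq_dividend order_trans)
  then have "hash (2 * n) w i * leaves K + A mod pr i \<le> 2 * n * leaves K + leaves K"
    using h by (intro add_mono mult_le_mono1)
  also have "\<dots> = (2 * n + 1) * leaves K" by simp
  also have "\<dots> \<le> N" using length_inp seeds_bounds(3)[of K] by (intro mult_bound) auto
  finally have p: "hash (2 * n) w i * leaves K + A mod pr i \<le> N" .
  have "hash (2 * n) w i \<le> N" using h n_bounds(3) by linarith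
  moreover have "G div (2 ^ K) ^ (hash (2 * n) w i * leaves K + A mod pr i) \<le> N" "A div pr i \<le> N"
    using le by (meson div_le_dividend order_trans)+
  moreover have "0 < length (D i)" using nonempty[OF assms(1)] by simp
  ultimately show ?thesis using le p pr assms(1) unfolding INDEX_def index_def
    by simp
qed

lemma index_less: "i < n \<Longrightarrow> index w G A i < length (D i)"
  using nonempty by (simp add: index_def)

lemma VALUE_correct [simp]:
  assumes "i < n" "w \<le> 2 * n" "G \<le> seeds K" "A \<le> leaves K"
  shows "eval inp [i, w, G, A] VALUE = val w G A i \<and> bnd inp N [i, w, G, A] VALUE"
  using assms rd_dom[OF assms(1) index_less[OF assms(1)]] by (simp add: VALUE_def val_def)

lemma MISMATCH_correct:
  assumes "j < length (constraints I)" "constraints I ! j = (s, R)" "t < length R"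
    and "w \<le> 2 * n" "G \<le> seeds K" "A \<le> leaves K"
  shows "eval inp [cptr j + length s + 2 + t * Suc (length s), cptr j, w, G, A] MISMATCH =
      (if R ! t = map (val w G A) s then 0 else 1) \<and>
    bnd inp N [cptr j + length s + 2 + t * Suc (length s), cptr j, w, G, A] MISMATCH"
proof -
  let ?env = "[cptr j + length s + 2 + t * Suc (length s), cptr j, w, G, A]"
  have sR: "(s, R) \<in> set (constraints I)" using assms by (metis nth_mem)
  have s: "s ! l < n" if "l < length s" for l
    using wf sR that by (auto simp: wf_qcsp_def)
  have "length (R ! t) = length s" using tuple_length[OF sR] assms(3) by simp
  then have eq: "R ! t = map (val w G A) s \<longleftrightarrow> (\<forall>l<length s. R ! t ! l = val w G A (s ! l))"
    by (simp add: list_eq_iff_nth_eq)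
  have "eval inp ?env MISMATCH =
      (if \<exists>l<length s. R ! t ! l \<noteq> val w G A (s ! l) then 1 else 0) \<and> bnd inp N ?env MISMATCH"
    unfolding MISMATCH_def
    by (rule Iter_search)
      (use assms s rd_constraint[OF assms(1,2)] constraint_le[OF assms(1,2)] in
        \<open>simp_all add: numeral_2_eq_2\<close>)
  then show ?thesis unfolding eq by auto
qed

lemma SAT_correct [simp]:
  assumes "j < length (constraints I)" "w \<le> 2 * n" "G \<le> seeds K" "A \<le> leaves K"
  shows "eval inp [cptr j, w, G, A] SAT =
      (if satisfies (map (val w G A) [0..<n]) (constraints I ! j) then 1 else 0) \<and>
    bnd inp N [cptr j, w, G, A] SAT"
proof -
  obtain s R where j: "constraints I ! j = (s, R)" by (cases "constraints I ! j")
  then have sR: "(s, R) \<in> set (constraints I)" using assms by (metis nth_mem)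
  have map_eq: "map ((!) (map (val w G A) [0..<n])) s = map (val w G A) s"
    using wf sR by (auto simp: wf_qcsp_def)
  then have eq: "satisfies (map (val w G A) [0..<n]) (constraints I ! j) \<longleftrightarrow>
      (\<exists>t<length R. R ! t = map (val w G A) s)"
    unfolding satisfies_def j fst_conv snd_conv map_eq in_set_conv_nth by blast
  show ?thesis unfolding SAT_def eq
  proof (rule Iter_search)
    fix t a assume t: "t < length R"
    then have "t \<le> N" using constraint_le[OF assms(1) j] by simp
    then show "eval inp ([cptr j, w, G, A] @ [t, a])
         (IfZero (App MISMATCH
           [Plus (Plus (Plus (Var 0) (Inp (Var 0))) (Const 2)) (App MUL [Var 4, Plus (Inp (Var 0)) (Const 1)]),
            Var 0, Var 1, Var 2, Var 3]) (Const 1) (Var 5)) =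
        (if R ! t = map (val w G A) s then 1 else a) \<and>
      bnd inp N ([cptr j, w, G, A] @ [t, a])
         (IfZero (App MISMATCH
           [Plus (Plus (Plus (Var 0) (Inp (Var 0))) (Const 2)) (App MUL [Var 4, Plus (Inp (Var 0)) (Const 1)]),
            Var 0, Var 1, Var 2, Var 3]) (Const 1) (Var 5))"
      using MISMATCH_correct[OF assms(1) j t assms(2-4)] rd_constraint[OF assms(1) j] by simp
  qed (use rd_constraint[OF assms(1) j] constraint_le[OF assms(1) j] in simp_all)
qed

definition "all_sat w G A \<longleftrightarrow>
  (\<forall>C\<in>set (constraints I). satisfies (map (val w G A) [0..<n]) C)"

lemma ALL_SAT_correct [simp]:
  assumes "w \<le> 2 * n" "G \<le> seeds K" "A \<le> leaves K"
  shows "eval inp [w, G, A] ALL_SAT = (if all_sat w G A then 1 else 0) \<and>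
    bnd inp N [w, G, A] ALL_SAT"
proof -
  have "eval inp [w, G, A] ALL_SAT =
      (if \<exists>j<length (constraints I). \<not> satisfies (map (val w G A) [0..<n]) (constraints I ! j)
       then 0 else 1) \<and> bnd inp N [w, G, A] ALL_SAT"
    unfolding ALL_SAT_def by (rule Iter_search) (use assms in auto)
  then show ?thesis by (simp add: all_sat_def all_set_conv_all_nth)
qed

lemma WINS_correct [simp]:
  assumes "w \<le> 2 * n" "G \<le> seeds K"
  shows "eval inp [w, G] WINS = (if \<forall>A<pr n. \<not> all_sat w G A then 1 else 0) \<and>
    bnd inp N [w, G] WINS"
proof -
  have pr: "pr n \<le> leaves K" by (simp add: pr_le_leaves)
  then have "pr n \<le> N" using seeds_bounds(3)[of K] seeds_le by linarith
  then have "eval inp [w, G] WINS = (if \<exists>A<pr n. all_sat w G A then 0 else 1) \<and>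
      bnd inp N [w, G] WINS"
    unfolding WINS_def by (intro Iter_search) (use assms pr in auto)
  then show ?thesis by auto
qed

lemma SOME_SEED_correct [simp]:
  assumes "w \<le> 2 * n"
  shows "eval inp [w] SOME_SEED = (if \<exists>G<seeds K. \<forall>A<pr n. \<not> all_sat w G A then 1 else 0) \<and>
    bnd inp N [w] SOME_SEED"
  unfolding SOME_SEED_def by (rule Iter_search) (use assms in auto)

lemma UNIV_WINS_correct [simp]:
  "eval inp [] UNIV_WINS =
      (if \<exists>w<2 * n + 1. \<exists>G<seeds K. \<forall>A<pr n. \<not> all_sat w G A then 1 else 0) \<and>
    bnd inp N [] UNIV_WINS"
  unfolding UNIV_WINS_def
  by (rule Iter_search) (use n_bounds(4) in \<open>auto simp: mult_2 simp del: n_bounds\<close>)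

section \<open>Completeness and soundness of the search\<close>

lemma nonempty_prefix: "\<forall>(q, D)\<in>set (qprefix I). D \<noteq> []"
proof (clarify)
  fix q assume "(q, []) \<in> set (qprefix I)"
  then obtain i where "i < n" "qprefix I ! i = (q, [])" by (auto simp: in_set_conv_nth)
  with nonempty[of i] show False by simp
qed

text \<open>
  A winning strategy needs to violate only one constraint per existential play, so only boundedly
  many variables matter to it. A hash that keeps these variables apart together with a suitable seed
  agrees with the strategy on them.
\<close>

lemma ex_seed_agreeing:
  assumes V: "V \<subseteq> {..<n}" "card V \<le> K * leaves K"
  shows "\<exists>w<2 * n + 1. \<exists>G<seeds K. \<forall>A<pr n. \<forall>u\<in>V. val w G A u = play \<sigma> A 0 (Suc 0) (qprefix I) ! u"
proof -
  obtain l where l: "n \<le> 2 ^ l" "2 ^ l \<le> 2 * n + 1" using ex_power_of_two by blast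
  have "V \<subseteq> {..<2 ^ l}" using V(1) l(1) by auto
  from ex_hash[OF this] obtain w where w: "w < 2 ^ l" "inj_on (hash l w) V" "\<And>u. hash l w u < 2 ^ card V"
    by blast
  have "l \<le> 2 * n" using l(2) less_exp[of l] by linarith
  then have h: "hash (2 * n) w u = hash l w u" for u by (rule hash_extend[OF w(1)])
  let ?h = "hash (2 * n) w"
  have inj: "inj_on ?h V" using w(2) h by (simp add: inj_on_def)
  have h_less: "?h u < 2 ^ (K * leaves K)" for u
  proof -
    have "?h u < 2 ^ card V" using w(3) h by simp
    also have "\<dots> \<le> 2 ^ (K * leaves K)" using V(2) by (intro power_increasing) auto
    finally show ?thesis .
  qed
  \<comment> \<open>One row for each possible hash value and one column for each code of preceding
    existential moves. Row \<open>p div leaves K\<close> belongs to \<open>var p\<close>, the only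
    such variable in \<open>V\<close> because the hash separates \<open>V\<close>.\<close>
  define m where "m = leaves K * 2 ^ (K * leaves K)"
  define var where "var p = inv_into V ?h (p div leaves K)" for p
  define used where "used p \<longleftrightarrow> p div leaves K \<in> ?h ` V" for p
  \<comment> \<open>Entries whose row belongs to no variable in \<open>V\<close> get modulus 1 and
    value 0, which every seed satisfies.\<close>
  define \<mu> where "\<mu> p = (if used p then length (D (var p)) else 1)" for p
  define \<phi> where "\<phi> p = (if used p then \<sigma> (var p) (p mod leaves K) mod length (D (var p)) else 0)" for p
  have "\<exists>G<(2 ^ K) ^ m. \<forall>p<m. G div (2 ^ K) ^ p mod \<mu> p = \<phi> p"
  proof (rule ex_seed)
    fix p
    show "\<phi> p < \<mu> p \<and> \<mu> p \<le> 2 ^ K"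
    proof (cases "used p")
      case True
      then have "var p \<in> V" unfolding used_def var_def by (rule inv_into_into)
      then have "var p < n" using V(1) by auto
      then show ?thesis using True nonempty[of "var p"] length_D_le_pow[of "var p"]
        by (simp add: \<phi>_def \<mu>_def)
    qed (simp add: \<phi>_def \<mu>_def)
  qed
  moreover have "(2 ^ K) ^ m = seeds K" by (simp add: seeds_def m_def power_mult)
  ultimately obtain G where G: "G < seeds K" "\<And>p. p < m \<Longrightarrow> G div (2 ^ K) ^ p mod \<mu> p = \<phi> p" by auto
  have "val w G A u = play \<sigma> A 0 (Suc 0) (qprefix I) ! u" if u: "u \<in> V" for A u
  proof -
    have un: "u < n" using u V(1) by auto
    let ?c = "A mod pr u" and ?p = "?h u * leaves K + A mod pr u"
    have c: "?c < leaves K"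
      using pr_pos[of u] pr_le_leaves[of u] un mod_less_divisor[of "pr u" A] by linarith
    have "?p < Suc (?h u) * leaves K" using c by simp
    also have "\<dots> \<le> 2 ^ (K * leaves K) * leaves K" using h_less[of u] by (intro mult_le_mono1) simp
    finally have p: "?p < m" by (simp add: m_def mult.commute)
    \<comment> \<open>As the column is below \<open>leaves K\<close>, division recovers row and
      column from the position.\<close>
    have pd: "?p div leaves K = ?h u" "?p mod leaves K = ?c" using c by simp_all
    then have "used ?p" "var ?p = u" using u inj by (simp_all add: used_def var_def)
    with G(2)[OF p] pd have "G div (2 ^ K) ^ ?p mod length (D u) = \<sigma> u ?c mod length (D u)"
      by (simp add: \<mu>_def \<phi>_def)
    then show ?thesis using un by (simp add: play_nth_pr val_def index_def)
  qed
  moreover have "w < 2 * n + 1" using w(1) l(2) by linarith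
  ultimately show ?thesis using G(1) by blast
qed

lemma not_qcsp_true_iff:
  "\<not> qcsp_true I \<longleftrightarrow> (\<exists>w<2 * n + 1. \<exists>G<seeds K. \<forall>A<pr n. \<not> all_sat w G A)"
proof
  assume "\<not> qcsp_true I"
  then obtain \<sigma> where "\<And>A. \<exists>C\<in>set (constraints I). \<not> satisfies (play \<sigma> A 0 (Suc 0) (qprefix I)) C"
    using not_qtrue_strategy[of "qprefix I" "[]" "constraints I" 0 "Suc 0" 0] nonempty_prefix
    unfolding qcsp_true_def by auto
  then obtain f where f: "\<And>A. f A \<in> set (constraints I)"
    "\<And>A. \<not> satisfies (play \<sigma> A 0 (Suc 0) (qprefix I)) (f A)" by metis
  \<comment> \<open>One violated constraint is chosen for each of at most \<open>leaves K\<close>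
    plays, and its scope has at most \<open>K\<close> variables.\<close>
  define V where "V = (\<Union>A<pr n. set (fst (f A)))"
  have "card (set (fst (f A))) \<le> K" for A
  proof -
    have "length (fst (f A)) \<le> max_arity I" unfolding max_arity_def using f(1) by (intro Max_ge) auto
    then show ?thesis using card_length[of "fst (f A)"] by linarith
  qed
  then have "card V \<le> (\<Sum>A<pr n. K)"
    unfolding V_def by (intro order_trans[OF card_UN_le] sum_mono) auto
  also have "\<dots> \<le> K * leaves K" using pr_le_leaves[of n] by simp
  finally have "card V \<le> K * leaves K" .
  moreover have "V \<subseteq> {..<n}" unfolding V_def using scope_less[OF f(1)] by auto
  ultimately obtain w G where wG: "w < 2 * n + 1" "G < seeds K"
    "\<And>A u. A < pr n \<Longrightarrow> u \<in> V \<Longrightarrow> val w G A u = play \<sigma> A 0 (Suc 0) (qprefix I) ! u"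
    using ex_seed_agreeing[of V \<sigma>] by blast
  have "\<not> all_sat w G A" if A: "A < pr n" for A
  proof -
    have eq: "map ((!) (map (val w G A) [0..<n])) (fst (f A)) =
        map ((!) (play \<sigma> A 0 (Suc 0) (qprefix I))) (fst (f A))"
      using wG(3)[OF A] A scope_less[OF f(1)] unfolding V_def by auto
    have "\<not> satisfies (map (val w G A) [0..<n]) (f A)" using f(2)[of A] unfolding satisfies_def eq .
    then show ?thesis using f(1) by (auto simp: all_sat_def)
  qed
  with wG(1,2) show "\<exists>w<2 * n + 1. \<exists>G<seeds K. \<forall>A<pr n. \<not> all_sat w G A" by blast
next
  assume "\<exists>w<2 * n + 1. \<exists>G<seeds K. \<forall>A<pr n. \<not> all_sat w G A"
  then obtain w G where wG: "\<forall>A<pr n. \<not> all_sat w G A" by blast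
  show "\<not> qcsp_true I"
  proof
    assume "qcsp_true I"
    \<comment> \<open>Mask and seed define a strategy, and in a true instance some play against it
      satisfies all constraints.\<close>
    then obtain A where "A < num_leaves (qprefix I)"
      "\<forall>C\<in>set (constraints I). satisfies (play (choice w G) A 0 (Suc 0) (qprefix I)) C"
      using qtrue_beats[of "qprefix I" "[]" "constraints I" 0 "Suc 0" "choice w G" 0] nonempty_prefix
      by (auto simp: qcsp_true_def)
    moreover from this have "A < pr n" using num_leaves_take[of n] by simp
    ultimately show False using wG by (auto simp: all_sat_def val_eq_play)
  qed
qed

end

context qcsp_machine
begin

lemma DECIDE_correct:
  "eval inp [] DECIDE = (if qcsp_true I then 1 else 0) \<and> bnd inp N [] DECIDE"
proof (cases "\<exists>i<n. D i = []")
  case True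
  then have "qcsp_true I \<longleftrightarrow> \<not> ex (LEAST i. D i = [])"
    unfolding qcsp_true_def by (subst qtrue_empty_domain) (auto intro: quantifier.exhaust)
  then show ?thesis using True by (simp add: DECIDE_def)
next
  case False
  then interpret nonempty_qcsp_machine I N by unfold_locales auto
  have "eval inp [] FIRST_EMPTY = 2" "bnd inp N [] FIRST_EMPTY" using False by auto
  then show ?thesis using not_qcsp_true_iff by (auto simp: DECIDE_def)
qed

end


section \<open>Fixed-parameter tractability\<close>

lemma length_le_input_size: "length w \<le> input_size w"
  by (induction w) (auto simp: input_size_def)

lemma ram_computable_time: "ram_computable (\<lambda>k. c * (4 * seeds k) ^ m)"
proof -
  let ?S = "App SEEDS [Var 0]"
  let ?p = "App (Iter (Const m) (Const c) (App MUL [Plus (Plus ?S ?S) (Plus ?S ?S), Var 2])) [Inp (Const 0)]"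
  \<comment> \<open>Values do not depend on \<open>N\<close>, so the bound may be chosen as large as
    the correctness lemma asks.\<close>
  have mul: "eval inp [x, y] MUL = x * y" for inp x y
    using machine.MUL_correct[of x x] by blast
  have seeds: "eval inp [k] SEEDS = seeds k" for inp k
    using machine.SEEDS_correct[of k "seeds k"] by blast
  have "rec_nat c (\<lambda>j a. (seeds k + seeds k + (seeds k + seeds k)) * a) i = c * (4 * seeds k) ^ i" for k i
    by (induction i) auto
  then have "eval [k] [] ?p = c * (4 * seeds k) ^ m" for k
    by (simp add: mul seeds rd_def)
  then have "(\<lambda>k. eval [k] [] ?p) = (\<lambda>k. c * (4 * seeds k) ^ m)" by blast
  with ram_computable_eval[of ?p] show ?thesis by simp
qed

theorem theorem11:
  shows "fixed_parameter_tractable enc_qcsp {I. wf_qcsp I} {I. wf_qcsp I \<and> qcsp_true I}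
           (\<lambda>I. num_existential I + domain_size I + max_arity I)"
proof -
  obtain c m where time: "\<And>N. N \<ge> 1 \<Longrightarrow> time_bound N DECIDE \<le> c * N ^ m"
    using time_bound_polynomial[of DECIDE] by blast
  let ?f = "\<lambda>k. c * (4 * seeds k) ^ m"
  have "ram_outputs_within (code 0 [] 0 DECIDE) (enc_qcsp I)
      (?f (num_existential I + domain_size I + max_arity I) * input_size (enc_qcsp I) ^ m)
      (if I \<in> {I. wf_qcsp I \<and> qcsp_true I} then 1 else 0)" if I: "wf_qcsp I" for I
  proof -
    let ?K = "num_existential I + domain_size I + max_arity I"
    let ?N = "4 * length (enc_qcsp I) * seeds ?K"
    interpret qcsp_machine I ?N using I by unfold_locales auto
    have "1 \<le> ?N" using length_inp by (simp add: seeds_def)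
    then have "time_bound ?N DECIDE \<le> c * ?N ^ m" by (rule time)
    \<comment> \<open>Parameter and input length enter \<open>N\<close> as factors, so its power
      splits into a function of the parameter and a power of the length.\<close>
    also have "\<dots> = ?f ?K * length (enc_qcsp I) ^ m" by (simp add: power_mult_distrib)
    also have "\<dots> \<le> ?f ?K * input_size (enc_qcsp I) ^ m"
      by (intro mult_le_mono2 power_mono length_le_input_size) simp
    finally show ?thesis using ram_outputs_eval[of "enc_qcsp I" ?N DECIDE] DECIDE_correct I by auto
  qed
  then show ?thesis unfolding fixed_parameter_tractable_def using ram_computable_time[of c m] by blast
qed

end
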